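(* Let $(\mathbf{X},d,\mu)$ be a complete geodesic space with $\mu$ a doubling measure. Suppose that $\Omega\subsetneq\mathbf{X}$ is a bounded domain such that $(\overline{\Omega},d,\mu)$ is doubling and satisfies the $\infty$-weak Fubini property. Let $f$ be a positive Borel function on $\overline{\Omega}$ with $f\in L^\infty(\overline{\Omega})$ and $\inf_\Omega f>0$. Let $g:\partial\Omega\to\mathbb{R}$ satisfy $$g(x)\le\tilde L_f(x,y)+g(y)\quad\text{for all }x,y\in\partial\Omega,$$ and let $$\tilde u(x)=\inf_{y\in\partial\Omega}\{\tilde L_f(x,y)+g(y)\},\qquad x\in\overline{\Omega}.$$ Then $v\le\tilde u$ in $\overline{\Omega}$ for all $v\in S_{weak}$. If in addition $f$ is upper semicontinuous almost everywhere, i.e. there exists a set $N\subset\Omega$ with $\mu(N)=0$ such that $f|_{\Omega\setminus N}$ is upper semicontinuous, then $\tilde u$ is a weak subsolution of $|\nabla u|=f$ in $\Omega$, $u=g$ on $\partial\Omega$ (i.e. $\tilde u\in S_{weak}$). In particular, $\tilde u$ is the maximal weak subsolution in the sense that $$\tilde u(x)=\sup\{v(x):v\in S_{weak}\}\quad\text{for all }x\in\Omega.$$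
   Context: For a null set $N\subset\overline{\Omega}$ ($\mu(N)=0$), a curve $\gamma$ is transversal to $N$ if $\mathcal{H}^1(\gamma^{-1}(N))=0$, where $\mathcal H^1$ is one-dimensional Hausdorff measure. For $x,y\in\overline\Omega$, $\Gamma_f^N(x,y)$ is the set of rectifiable curves $\gamma:[0,\ell]\to\overline{\Omega}$, parametrized by arc length, with $\gamma(0)=x$, $\gamma(\ell)=y$, $\int_\gamma f\,ds<\infty$ and $\gamma$ transversal to $N$ (the constant curve is allowed when $x=y$, so the quantities below vanish then). Set $$L_f^N(x,y)=\inf\Big\{\int_\gamma f\,ds:\gamma\in\Gamma_f^N(x,y)\Big\},\qquad \tilde L_f(x,y)=\sup_{\mu(N)=0}L_f^N(x,y).$$ A metric measure space satisfies the $\infty$-weak Fubini property if for any null set $N$, any $\varepsilon>0$ and any distinct points $x,y$ in the space, there is a curve $\gamma$ in the space connecting $x,y$, transversal to $N$, with length $\ell(\gamma)\le d(x,y)+\varepsilon$. The slope of $v$ is $|\nabla v|(x)=\limsup_{d(x,y)\to0}\frac{|v(y)-v(x)|}{d(x,y)}$ for $x\in\Omega$. The class of weak subsolutions of the Dirichlet problem is $$S_{weak}:=\{v\in \mathrm{Lip}_{loc}(\Omega)\cap C(\overline{\Omega}):\ |\nabla v|(x)\le f(x)\ \text{for a.e. }x\in\Omega\ \text{and}\ v\le g\ \text{on }\partial\Omega\},$$ where local Lipschitz continuity and continuity are with respect to $d$. Doubling means: balls have positive finite measure and $\mu(B_{2r}(x))\le C_d\,\mu(B_r(x))$ for a constant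 $C_d\geq 1$ and all $x$, $r>0$. *)

theory Defs
  imports "HOL-Analysis.Analysis"
begin

subsection \<open>Curves\<close>

definition geodesic_space :: "'a::metric_space itself \<Rightarrow> bool" where
  "geodesic_space _ \<longleftrightarrow>
     (\<forall>x y::'a. \<exists>\<gamma>. \<gamma> 0 = x \<and> \<gamma> (dist x y) = y \<and>
        (\<forall>s\<in>{0..dist x y}. \<forall>t\<in>{0..dist x y}. dist (\<gamma> s) (\<gamma> t) = \<bar>s - t\<bar>))"

definition curve_length :: "(real \<Rightarrow> 'a::metric_space) \<Rightarrow> real \<Rightarrow> real \<Rightarrow> ennreal" where
  "curve_length \<gamma> a b =
     Sup {ennreal (\<Sum>i<n. dist (\<gamma> (t i)) (\<gamma> (t (Suc i)))) | (n::nat) (t::nat \<Rightarrow> real).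
            mono_on {..n} t \<and> t 0 = a \<and> t n = b}"

text \<open>
  A rectifiable curve in \<open>E\<close> from \<open>x\<close> to \<open>y\<close>, parametrized by arc length on \<open>{0..l}\<close>;
  its length is \<open>l\<close>. For \<open>l = 0\<close> this is the constant curve. Values of \<open>\<gamma>\<close> outside
  \<open>{0..l}\<close> are irrelevant.
\<close>
definition arclength_curve ::
  "'a::metric_space set \<Rightarrow> 'a \<Rightarrow> 'a \<Rightarrow> real \<Rightarrow> (real \<Rightarrow> 'a) \<Rightarrow> bool" where
  "arclength_curve E x y l \<gamma> \<longleftrightarrow>
     0 \<le> l \<and> continuous_on {0..l} \<gamma> \<and> \<gamma> ` {0..l} \<subseteq> E \<and> \<gamma> 0 = x \<and> \<gamma> l = y \<and>
     (\<forall>s t. 0 \<le> s \<and> s \<le> t \<and> t \<le> l \<longrightarrow> curve_length \<gamma> s t = ennreal (t - s))"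

definition curve_integral :: "('a \<Rightarrow> real) \<Rightarrow> real \<Rightarrow> (real \<Rightarrow> 'a) \<Rightarrow> ennreal" where
  "curve_integral f l \<gamma> = (\<integral>\<^sup>+t\<in>{0..l}. ennreal (f (\<gamma> t)) \<partial>lborel)"

subsection \<open>Null sets and transversality\<close>

text \<open>One-dimensional Hausdorff measure, as an outer measure on all subsets.\<close>
definition hausdorff1_pre :: "real \<Rightarrow> 'a::metric_space set \<Rightarrow> ennreal" where
  "hausdorff1_pre \<delta> A =
     Inf {(\<Sum>i. ennreal (diameter (U i))) | U::nat \<Rightarrow> 'a set.
            A \<subseteq> (\<Union>i. U i) \<and> (\<forall>i. bounded (U i) \<and> diameter (U i) \<le> \<delta>)}"

definition hausdorff1 :: "'a::metric_space set \<Rightarrow> ennreal" where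
  "hausdorff1 A = (SUP \<delta>\<in>{0<..}. hausdorff1_pre \<delta> A)"

text \<open>
  Measures here live on the Borel sets; a null set is any subset of a Borel set of measure
  zero, i.e. a set whose outer measure vanishes.
\<close>
definition null_subsets :: "'a measure \<Rightarrow> 'a set \<Rightarrow> 'a set set" where
  "null_subsets M E = {N. N \<subseteq> E \<and> N \<in> null_sets (completion M)}"

definition transversal :: "real \<Rightarrow> (real \<Rightarrow> 'a) \<Rightarrow> 'a set \<Rightarrow> bool" where
  "transversal l \<gamma> N \<longleftrightarrow> hausdorff1 {t\<in>{0..l}. \<gamma> t \<in> N} = 0"

subsection \<open>Doubling and the weak Fubini property\<close>

text \<open>The balls of the metric subspace \<open>E\<close> are the sets \<open>ball x r \<inter> E\<close> with \<open>x \<in> E\<close>.\<close>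
definition doubling_on :: "'a::metric_space set \<Rightarrow> 'a measure \<Rightarrow> bool" where
  "doubling_on E M \<longleftrightarrow>
     (\<exists>C::real. 1 \<le> C \<and> (\<forall>x\<in>E. \<forall>r>0.
        0 < emeasure M (ball x r \<inter> E) \<and> emeasure M (ball x r \<inter> E) < \<infinity> \<and>
        emeasure M (ball x (2 * r) \<inter> E) \<le> ennreal C * emeasure M (ball x r \<inter> E)))"

definition infinity_weak_Fubini :: "'a::metric_space set \<Rightarrow> 'a measure \<Rightarrow> bool" where
  "infinity_weak_Fubini E M \<longleftrightarrow>
     (\<forall>N\<in>null_subsets M E. \<forall>\<epsilon>>0. \<forall>x\<in>E. \<forall>y\<in>E. x \<noteq> y \<longrightarrow>
        (\<exists>l \<gamma>. arclength_curve E x y l \<gamma> \<and> transversal l \<gamma> N \<and> l \<le> dist x y + \<epsilon>))"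

subsection \<open>The optical length function\<close>

definition Gamma_curves ::
  "'a::metric_space set \<Rightarrow> ('a \<Rightarrow> real) \<Rightarrow> 'a set \<Rightarrow> 'a \<Rightarrow> 'a \<Rightarrow> (real \<times> (real \<Rightarrow> 'a)) set" where
  "Gamma_curves E f N x y =
     {(l, \<gamma>). arclength_curve E x y l \<gamma> \<and> curve_integral f l \<gamma> < \<infinity> \<and> transversal l \<gamma> N}"

definition L_null ::
  "'a::metric_space set \<Rightarrow> ('a \<Rightarrow> real) \<Rightarrow> 'a set \<Rightarrow> 'a \<Rightarrow> 'a \<Rightarrow> ennreal" where
  "L_null E f N x y = (INF (l, \<gamma>)\<in>Gamma_curves E f N x y. curve_integral f l \<gamma>)"

definition L_tilde ::
  "'a::metric_space set \<Rightarrow> 'a measure \<Rightarrow> ('a \<Rightarrow> real) \<Rightarrow> 'a \<Rightarrow> 'a \<Rightarrow> ennreal" where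
  "L_tilde E M f x y = (SUP N\<in>null_subsets M E. L_null E f N x y)"

definition u_tilde ::
  "'a::metric_space set \<Rightarrow> 'a measure \<Rightarrow> ('a \<Rightarrow> real) \<Rightarrow> ('a \<Rightarrow> real) \<Rightarrow> 'a \<Rightarrow> ereal" where
  "u_tilde \<Omega> M f g x =
     (INF y\<in>frontier \<Omega>. enn2ereal (L_tilde (closure \<Omega>) M f x y) + ereal (g y))"

subsection \<open>Weak subsolutions\<close>

definition slope :: "'a::metric_space set \<Rightarrow> ('a \<Rightarrow> real) \<Rightarrow> 'a \<Rightarrow> ereal" where
  "slope \<Omega> v x = Limsup (at x within \<Omega>) (\<lambda>y. ereal (\<bar>v y - v x\<bar> / dist x y))"

definition locally_Lipschitz_on :: "'a::metric_space set \<Rightarrow> ('a \<Rightarrow> real) \<Rightarrow> bool" where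
  "locally_Lipschitz_on \<Omega> v \<longleftrightarrow> (\<forall>x\<in>\<Omega>. \<exists>r>0. \<exists>C. C-lipschitz_on (ball x r \<inter> \<Omega>) v)"

text \<open>Functions on \<open>closure \<Omega>\<close> are total functions whose values elsewhere are unconstrained.\<close>
definition S_weak ::
  "'a::metric_space set \<Rightarrow> 'a measure \<Rightarrow> ('a \<Rightarrow> real) \<Rightarrow> ('a \<Rightarrow> real) \<Rightarrow> ('a \<Rightarrow> real) set" where
  "S_weak \<Omega> M f g =
     {v. locally_Lipschitz_on \<Omega> v \<and> continuous_on (closure \<Omega>) v \<and>
         (AE x in M. x \<in> \<Omega> \<longrightarrow> slope \<Omega> v x \<le> ereal (f x)) \<and>
         (\<forall>x\<in>frontier \<Omega>. v x \<le> g x)}"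

definition usc_on :: "'a::topological_space set \<Rightarrow> ('a \<Rightarrow> real) \<Rightarrow> bool" where
  "usc_on A f \<longleftrightarrow> (\<forall>a. openin (top_of_set A) {x\<in>A. f x < a})"

end

theory Submission
  imports Defs
begin

text \<open>
  Integrating the slope bound along a curve gives \<open>v x - v z \<le> \<integral>\<^sub>\<gamma> f\<close> for a weak subsolution
  \<open>v\<close>, as long as the curve stays inside \<open>\<Omega>\<close> and is transversal to the null set where the bound
  fails (\<open>decrease_along_curve_le_integral\<close>). A curve from \<open>x\<close> to a boundary point \<open>y\<close> is followed
  up to its first boundary point \<open>z\<close>; from there on the boundary datum takes over, since
  \<open>v z \<le> g z \<le> L_tilde z y + g y\<close>. For this the length of the remaining piece has to dominate
  \<open>L_tilde z y\<close>, although the piece is transversal to one null set only and \<open>z\<close> depends on the curve.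
  So a single null set \<open>N\<close> with \<open>L_null N = L_tilde\<close> for all pairs of points is needed. It exists
  because the optical lengths are uniformly Lipschitz, by the weak Fubini property and the
  essential boundedness of \<open>f\<close>, while the bounded set \<open>closure \<Omega>\<close> is separable, by the doubling
  property (\<open>L_tilde_attained\<close>). This gives \<open>v \<le> u_tilde\<close>
  (\<open>weak_subsolution_le_u_tilde\<close>).

  Conversely, \<open>u_tilde\<close> changes between two points by at most their optical length
  (\<open>u_tilde_finite_and_controlled\<close>), so it is Lipschitz. At a point \<open>x\<close> outside the exceptional null
  set, upper semicontinuity bounds \<open>f\<close> by \<open>f x + e\<close> near \<open>x\<close>, and the weak Fubini property
  bounds the optical length by \<open>(f x + e) * dist x y\<close> there (\<open>u_tilde_slope_le\<close>). Hence
  \<open>u_tilde\<close> is itself a weak subsolution, and by the first part it is the largest one.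
\<close>

section \<open>Sets of vanishing one-dimensional Hausdorff measure\<close>

lemma hausdorff1_eq_0_iff:
  "hausdorff1 A = 0 \<longleftrightarrow>
    (\<forall>\<delta>>0. \<forall>e>0. \<exists>U::nat \<Rightarrow> 'a::metric_space set.
       A \<subseteq> (\<Union>i. U i) \<and> (\<forall>i. bounded (U i) \<and> diameter (U i) \<le> \<delta>) \<and>
       (\<Sum>i. ennreal (diameter (U i))) < ennreal e)"
  (is "_ \<longleftrightarrow> ?R")
proof
  assume 0: "hausdorff1 A = 0"
  show ?R
  proof (intro allI impI)
    fix \<delta> e :: real assume "\<delta> > 0" "e > 0"
    have "hausdorff1_pre \<delta> A \<le> hausdorff1 A"
      unfolding hausdorff1_def by (rule SUP_upper) (use \<open>\<delta> > 0\<close> in simp)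
    with 0 \<open>e > 0\<close> have "hausdorff1_pre \<delta> A < ennreal e"
      by simp
    then show "\<exists>U. A \<subseteq> (\<Union>i. U i) \<and> (\<forall>i. bounded (U i) \<and> diameter (U i) \<le> \<delta>) \<and>
        (\<Sum>i. ennreal (diameter (U i))) < ennreal e"
      unfolding hausdorff1_pre_def Inf_less_iff by blast
  qed
next
  assume R: ?R
  have "hausdorff1_pre \<delta> A \<le> 0" if "\<delta> > 0" for \<delta>
  proof (rule ennreal_le_epsilon)
    fix e :: real assume "e > 0"
    with R that obtain U where "A \<subseteq> (\<Union>i. U i) \<and> (\<forall>i. bounded (U i) \<and> diameter (U i) \<le> \<delta>)"
      and "(\<Sum>i. ennreal (diameter (U i))) < ennreal e"
      by blast
    then show "hausdorff1_pre \<delta> A \<le> 0 + ennreal e"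
      unfolding hausdorff1_pre_def by (auto intro!: Inf_lower2)
  qed
  then show "hausdorff1 A = 0"
    unfolding hausdorff1_def by (auto intro!: antisym SUP_least)
qed

lemma hausdorff1_0_subset:
  assumes "hausdorff1 B = 0" "A \<subseteq> B"
  shows "hausdorff1 A = 0"
  using assms unfolding hausdorff1_eq_0_iff by (meson order_trans)

lemma hausdorff1_0_singleton: "hausdorff1 {a} = 0"
  unfolding hausdorff1_eq_0_iff
proof (intro allI impI)
  fix \<delta> e :: real assume "\<delta> > 0" "e > 0"
  then show "\<exists>U. {a} \<subseteq> (\<Union>i. U i) \<and> (\<forall>i. bounded (U i) \<and> diameter (U i) \<le> \<delta>) \<and>
      (\<Sum>i::nat. ennreal (diameter (U i))) < ennreal e"
    by (intro exI[of _ "\<lambda>_. {a}"]) auto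
qed

text \<open>
  Covers of the two sets are interleaved: the even members of the new cover come from one, the odd
  members from the other.
\<close>
lemma hausdorff1_0_Un:
  assumes "hausdorff1 A = 0" "hausdorff1 B = 0"
  shows "hausdorff1 (A \<union> B) = 0"
  unfolding hausdorff1_eq_0_iff
proof (intro allI impI)
  fix \<delta> e :: real assume "\<delta> > 0" "e > 0"
  obtain U where U: "A \<subseteq> (\<Union>i. U i)" "\<And>i. bounded (U i) \<and> diameter (U i) \<le> \<delta>"
    and Us: "(\<Sum>i. ennreal (diameter (U i))) < ennreal (e/2)"
    using assms(1)[unfolded hausdorff1_eq_0_iff] \<open>\<delta> > 0\<close> \<open>e > 0\<close> half_gt_zero by metis
  obtain V where V: "B \<subseteq> (\<Union>i. V i)" "\<And>i. bounded (V i) \<and> diameter (V i) \<le> \<delta>"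
    and Vs: "(\<Sum>i. ennreal (diameter (V i))) < ennreal (e/2)"
    using assms(2)[unfolded hausdorff1_eq_0_iff] \<open>\<delta> > 0\<close> \<open>e > 0\<close> half_gt_zero by metis
  define W where "W i = (if even i then U (i div 2) else V (i div 2))" for i
  have U_sub: "(\<Union>i. U i) \<subseteq> (\<Union>i. W i)"
  proof (rule UN_least)
    fix i show "U i \<subseteq> (\<Union>i. W i)" by (rule order_trans[OF _ UN_upper[of "2*i"]]) (auto simp: W_def)
  qed
  have V_sub: "(\<Union>i. V i) \<subseteq> (\<Union>i. W i)"
  proof (rule UN_least)
    fix i show "V i \<subseteq> (\<Union>i. W i)" by (rule order_trans[OF _ UN_upper[of "2*i+1"]]) (auto simp: W_def)
  qed
  have split: "(\<Sum>i<2*n. ennreal (diameter (W i))) =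
      (\<Sum>i<n. ennreal (diameter (U i))) + (\<Sum>i<n. ennreal (diameter (V i)))" for n
    by (induction n) (auto simp: W_def algebra_simps)
  have "(\<Sum>i. ennreal (diameter (W i))) \<le>
      (\<Sum>i. ennreal (diameter (U i))) + (\<Sum>i. ennreal (diameter (V i)))"
  proof (rule suminf_le_const)
    fix n
    have "(\<Sum>i<n. ennreal (diameter (W i))) \<le> (\<Sum>i<2*n. ennreal (diameter (W i)))"
      by (rule sum_mono2) auto
    also have "\<dots> \<le> (\<Sum>i. ennreal (diameter (U i))) + (\<Sum>i. ennreal (diameter (V i)))"
      unfolding split by (intro add_mono sum_le_suminf) auto
    finally show "(\<Sum>i<n. ennreal (diameter (W i))) \<le> \<dots>" .
  qed auto
  also have "\<dots> < ennreal (e/2) + ennreal (e/2)"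
    using Us Vs by (rule add_strict_mono)
  also have "\<dots> = ennreal e"
    using \<open>e > 0\<close> by (simp flip: ennreal_plus)
  finally have "(\<Sum>i. ennreal (diameter (W i))) < ennreal e" .
  moreover have "A \<union> B \<subseteq> (\<Union>i. W i)"
    using U(1) V(1) U_sub V_sub by (intro Un_least) (rule order_trans; assumption)+
  moreover have "\<forall>i. bounded (W i) \<and> diameter (W i) \<le> \<delta>"
    using U(2) V(2) by (simp add: W_def)
  ultimately show "\<exists>W. A \<union> B \<subseteq> (\<Union>i. W i) \<and> (\<forall>i. bounded (W i) \<and> diameter (W i) \<le> \<delta>) \<and>
      (\<Sum>i::nat. ennreal (diameter (W i))) < ennreal e"
    by (intro exI[of _ W] conjI)
qed

lemma hausdorff1_0_translation:
  fixes A :: "'a::real_normed_vector set"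
  assumes "hausdorff1 A = 0"
  shows "hausdorff1 ((\<lambda>t. c + t) ` A) = 0"
  unfolding hausdorff1_eq_0_iff
proof (intro allI impI)
  fix \<delta> e :: real assume "\<delta> > 0" "e > 0"
  obtain U where U: "A \<subseteq> (\<Union>i. U i)" "\<And>i. bounded (U i) \<and> diameter (U i) \<le> \<delta>"
    and Us: "(\<Sum>i. ennreal (diameter (U i))) < ennreal e"
    using assms[unfolded hausdorff1_eq_0_iff] \<open>\<delta> > 0\<close> \<open>e > 0\<close> by metis
  have diam: "diameter ((\<lambda>t. c + t) ` S) = diameter S" for S :: "'a set"
  proof -
    have "(\<lambda>t. c + t) ` S \<times> (\<lambda>t. c + t) ` S = (\<lambda>(x, y). (c + x, c + y)) ` (S \<times> S)"
      by auto
    then show ?thesis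
      by (simp add: diameter_def image_image case_prod_unfold)
  qed
  have "(\<lambda>t. c + t) ` A \<subseteq> (\<Union>i. (\<lambda>t. c + t) ` U i)"
    using U(1) by blast
  then show "\<exists>U. (\<lambda>t. c + t) ` A \<subseteq> (\<Union>i. U i) \<and> (\<forall>i. bounded (U i) \<and> diameter (U i) \<le> \<delta>) \<and>
      (\<Sum>i::nat. ennreal (diameter (U i))) < ennreal e"
    using U(2) Us by (intro exI[of _ "\<lambda>i. (\<lambda>t. c + t) ` U i"]) (auto simp: diam bounded_translation)
qed

text \<open>
  A set of real numbers of diameter \<open>d\<close> lies in an interval of length \<open>2 d\<close> about any of its points,
  so a cover with small total diameter bounds the outer Lebesgue measure. This turns transversality
  into an almost-everywhere statement about the parameter of the curve.
\<close>
lemma hausdorff1_0_imp_negligible: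
  fixes A :: "real set"
  assumes "hausdorff1 A = 0"
  shows "negligible A"
  unfolding negligible_outer
proof (intro allI impI)
  fix e :: real assume "e > 0"
  obtain U where U: "A \<subseteq> (\<Union>i. U i)" "\<And>i. bounded (U i) \<and> diameter (U i) \<le> 1"
    and Us: "(\<Sum>i. ennreal (diameter (U i))) < ennreal (e/2)"
    using assms[unfolded hausdorff1_eq_0_iff] \<open>e > 0\<close> half_gt_zero zero_less_one by metis
  define V where "V i = (if U i = {} then {} else cball (SOME a. a \<in> U i) (diameter (U i)))" for i
  have UV: "U i \<subseteq> V i" for i
  proof
    fix x assume x: "x \<in> U i"
    then have "(SOME a. a \<in> U i) \<in> U i" by (rule someI)
    then have "dist (SOME a. a \<in> U i) x \<le> diameter (U i)"
      using x U(2) by (intro diameter_bounded_bound) auto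
    then show "x \<in> V i" using x by (auto simp: V_def)
  qed
  have Vm: "V i \<in> sets lborel" for i by (simp add: V_def)
  have V2: "emeasure lborel (V i) \<le> 2 * ennreal (diameter (U i))" for i
    using diameter_ge_0[of "U i"] U(2)[of i]
    by (auto simp: V_def cball_eq_atLeastAtMost ennreal_mult' simp flip: ennreal_numeral)
  have "emeasure lborel (\<Union>i. V i) \<le> (\<Sum>i. emeasure lborel (V i))"
    using Vm by (intro emeasure_subadditive_countably) auto
  also have "\<dots> \<le> (\<Sum>i. 2 * ennreal (diameter (U i)))"
    by (intro suminf_le V2) auto
  also have "\<dots> = 2 * (\<Sum>i. ennreal (diameter (U i)))"
    by simp
  also have "\<dots> < 2 * ennreal (e/2)"
    using Us by (intro ennreal_mult_strict_left_mono) auto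
  also have "\<dots> = ennreal e"
    using \<open>e > 0\<close> by (simp flip: ennreal_numeral ennreal_mult')
  finally have less: "emeasure lborel (\<Union>i. V i) < ennreal e" .
  then have "(\<Union>i. V i) \<in> lmeasurable"
    using Vm by (intro fmeasurableI) (auto intro: order.strict_trans2)
  moreover have "measure lebesgue (\<Union>i. V i) < e"
    using less Vm \<open>e > 0\<close>
    by (auto simp: measure_def enn2real_less_iff order.strict_trans[OF _ ennreal_less_top] sets.countable_UN)
  moreover have "A \<subseteq> (\<Union>i. V i)"
    using U(1) UV by blast
  ultimately show "\<exists>T. A \<subseteq> T \<and> T \<in> lmeasurable \<and> measure lebesgue T < e"
    by blast
qed

lemma transversal_AE:
  assumes "transversal l \<gamma> N"
  shows "AE t in lborel. t \<in> {0..l} \<longrightarrow> \<gamma> t \<notin> N"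
proof -
  have "{t\<in>{0..l}. \<gamma> t \<in> N} \<in> null_sets lebesgue"
    using assms by (simp add: transversal_def hausdorff1_0_imp_negligible flip: negligible_iff_null_sets)
  then have "AE t in lebesgue. t \<notin> {t\<in>{0..l}. \<gamma> t \<in> N}"
    by (rule AE_not_in)
  then show ?thesis
    unfolding AE_completion_iff by (auto elim!: eventually_mono)
qed

lemma transversal_subset:
  "transversal l \<gamma> N \<Longrightarrow> N' \<subseteq> N \<Longrightarrow> transversal l \<gamma> N'"
  unfolding transversal_def by (erule hausdorff1_0_subset) auto

section \<open>Curves parametrized by arc length\<close>

text \<open>
  The set whose supremum is the length; naming it allows the supremum to be moved across sums.
\<close>
definition chord_sums :: "(real \<Rightarrow> 'a::metric_space) \<Rightarrow> real \<Rightarrow> real \<Rightarrow> ennreal set" where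
  "chord_sums \<gamma> a b = {ennreal (\<Sum>i<n. dist (\<gamma> (t i)) (\<gamma> (t (Suc i)))) | (n::nat) (t::nat \<Rightarrow> real).
            mono_on {..n} t \<and> t 0 = a \<and> t n = b}"

lemma curve_length_eq_Sup: "curve_length \<gamma> a b = Sup (chord_sums \<gamma> a b)"
  by (simp add: curve_length_def chord_sums_def)

lemma dist_le_curve_length:
  assumes "s \<le> t"
  shows "ennreal (dist (\<gamma> s) (\<gamma> t)) \<le> curve_length \<gamma> s t"
  unfolding curve_length_def
proof (rule Sup_upper, rule CollectI, intro exI conjI)
  show "mono_on {..1::nat} (\<lambda>i. if i = 0 then s else t)"
    using assms by (auto simp: mono_on_def)
qed auto

lemma arclength_curve_dist_le:
  assumes "arclength_curve E x y l \<gamma>" "s \<in> {0..l}" "t \<in> {0..l}"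
  shows "dist (\<gamma> s) (\<gamma> t) \<le> \<bar>s - t\<bar>"
proof -
  have *: "dist (\<gamma> s) (\<gamma> t) \<le> t - s" if "0 \<le> s" "s \<le> t" "t \<le> l" for s t
  proof -
    have "ennreal (dist (\<gamma> s) (\<gamma> t)) \<le> ennreal (t - s)"
      using dist_le_curve_length[OF \<open>s \<le> t\<close>, of \<gamma>] assms(1) that by (simp add: arclength_curve_def)
    then show ?thesis using that by simp
  qed
  show ?thesis
    using *[of s t] *[of t s] assms(2,3) by (cases "s \<le> t") (auto simp: dist_commute)
qed

lemma curve_length_le_of_nonexpanding:
  assumes "\<And>s t. a \<le> s \<Longrightarrow> s \<le> t \<Longrightarrow> t \<le> b \<Longrightarrow> dist (\<gamma> s) (\<gamma> t) \<le> t - s"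
  shows "curve_length \<gamma> a b \<le> ennreal (b - a)"
  unfolding curve_length_def
proof (rule Sup_least, clarify)
  fix n and t :: "nat \<Rightarrow> real"
  assume mono: "mono_on {..n} t" and "a = t 0" "b = t n"
  have "(\<Sum>i<n. dist (\<gamma> (t i)) (\<gamma> (t (Suc i)))) \<le> (\<Sum>i<n. t (Suc i) - t i)"
  proof (rule sum_mono)
    fix i assume "i \<in> {..<n}"
    then have "t 0 \<le> t i" "t i \<le> t (Suc i)" "t (Suc i) \<le> t n"
      using mono by (auto simp: mono_on_def)
    then show "dist (\<gamma> (t i)) (\<gamma> (t (Suc i))) \<le> t (Suc i) - t i"
      using assms \<open>a = t 0\<close> \<open>b = t n\<close> by simp
  qed
  also have "\<dots> = t n - t 0" by (rule sum_lessThan_telescope)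
  finally show "ennreal (\<Sum>i<n. dist (\<gamma> (t i)) (\<gamma> (t (Suc i)))) \<le> ennreal (t n - t 0)"
    by (rule ennreal_leI)
qed

lemma chord_sums_nonempty: "a \<le> b \<Longrightarrow> chord_sums \<gamma> a b \<noteq> {}"
proof -
  assume "a \<le> b"
  then have "mono_on {..1::nat} (\<lambda>i. if i = 0 then a else b)"
    by (auto simp: mono_on_def)
  then show ?thesis
    unfolding chord_sums_def
    by (auto intro!: exI[of _ "1::nat"] exI[of _ "\<lambda>i::nat. if i = 0 then a else b"])
qed

lemma chord_sums_add:
  assumes "S \<in> chord_sums \<gamma> a b" "T \<in> chord_sums \<gamma> b c"
  shows "S + T \<in> chord_sums \<gamma> a c"
proof -
  obtain n s where s: "mono_on {..n} s" "s 0 = a" "s n = b"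
    and S: "S = ennreal (\<Sum>i<n. dist (\<gamma> (s i)) (\<gamma> (s (Suc i))))"
    using assms(1) unfolding chord_sums_def by auto
  obtain m t where t: "mono_on {..m} t" "t 0 = b" "t m = c"
    and T: "T = ennreal (\<Sum>i<m. dist (\<gamma> (t i)) (\<gamma> (t (Suc i))))"
    using assms(2) unfolding chord_sums_def by auto
  define r where "r i = (if i \<le> n then s i else t (i - n))" for i
  have r_add: "r (n + i) = t i" for i
    using s t by (auto simp: r_def)
  have "mono_on {..n + m} r"
  proof (rule mono_onI)
    fix i j assume ij: "i \<in> {..n + m}" "j \<in> {..n + m}" "i \<le> j"
    consider "j \<le> n" | "i \<le> n" "n < j" | "n < i" by linarith
    then show "r i \<le> r j"
    proof cases
      case 1 then show ?thesis using s(1) ij by (auto simp: r_def mono_on_def)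
    next
      case 2
      then have "s i \<le> s n" "t 0 \<le> t (j - n)"
        using s(1) t(1) ij by (auto simp: mono_on_def)
      then show ?thesis using 2 s t by (simp add: r_def)
    next
      case 3
      then have "i - n \<le> j - n" "i - n \<in> {..m}" "j - n \<in> {..m}" using ij by auto
      with 3 ij show ?thesis using mono_onD[OF t(1)] by (simp add: r_def)
    qed
  qed
  moreover have "r 0 = a" "r (n + m) = c"
    using s r_add t by (auto simp: r_def)
  moreover have "(\<Sum>i<n + m. dist (\<gamma> (r i)) (\<gamma> (r (Suc i)))) =
      (\<Sum>i<n. dist (\<gamma> (s i)) (\<gamma> (s (Suc i)))) + (\<Sum>i<m. dist (\<gamma> (t i)) (\<gamma> (t (Suc i))))"
  proof -
    have "(\<Sum>i<n + m. dist (\<gamma> (r i)) (\<gamma> (r (Suc i)))) =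
      (\<Sum>i<n. dist (\<gamma> (r i)) (\<gamma> (r (Suc i)))) + (\<Sum>i<m. dist (\<gamma> (r (n + i))) (\<gamma> (r (n + Suc i))))"
      by (induction m) auto
    also have "(\<Sum>i<n. dist (\<gamma> (r i)) (\<gamma> (r (Suc i)))) = (\<Sum>i<n. dist (\<gamma> (s i)) (\<gamma> (s (Suc i))))"
      by (rule sum.cong) (auto simp: r_def)
    finally show ?thesis by (simp only: r_add)
  qed
  then have "S + T = ennreal (\<Sum>i<n + m. dist (\<gamma> (r i)) (\<gamma> (r (Suc i))))"
    by (simp add: S T sum_nonneg)
  ultimately show ?thesis
    unfolding chord_sums_def by blast
qed

text \<open>
  Partitions of the two intervals concatenate. The matching upper bound for arc-length curves is
  \<open>curve_length_le_of_nonexpanding\<close>.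
\<close>
lemma curve_length_superadditive:
  assumes "a \<le> b" "b \<le> c"
  shows "curve_length \<gamma> a b + curve_length \<gamma> b c \<le> curve_length \<gamma> a c"
proof -
  have "curve_length \<gamma> a b + curve_length \<gamma> b c =
      (SUP S\<in>chord_sums \<gamma> a b. S + curve_length \<gamma> b c)"
    using ennreal_SUP_add_left[OF chord_sums_nonempty[OF assms(1)], of "\<lambda>S. S", symmetric]
    by (simp add: curve_length_eq_Sup)
  also have "\<dots> \<le> curve_length \<gamma> a c"
  proof (rule SUP_least)
    fix S assume S: "S \<in> chord_sums \<gamma> a b"
    have "S + curve_length \<gamma> b c = (SUP T\<in>chord_sums \<gamma> b c. S + T)"
      using ennreal_SUP_add_right[OF chord_sums_nonempty[OF assms(2)], of S "\<lambda>S. S"]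
      by (simp add: curve_length_eq_Sup)
    also have "\<dots> \<le> curve_length \<gamma> a c"
      unfolding curve_length_eq_Sup[of _ a c] using S
      by (intro SUP_least Sup_upper chord_sums_add)
    finally show "S + curve_length \<gamma> b c \<le> curve_length \<gamma> a c" .
  qed
  finally show ?thesis .
qed

text \<open>
  A shift of the parameter is used in both directions, with \<open>c\<close> and with \<open>- c\<close>, so one inequality
  suffices for equality.
\<close>
lemma curve_length_le_of_reparametrization:
  assumes "\<And>t. a \<le> t \<Longrightarrow> t \<le> b \<Longrightarrow> \<gamma>' t = \<gamma> (t + c)"
  shows "curve_length \<gamma>' a b \<le> curve_length \<gamma> (a + c) (b + c)"
  unfolding curve_length_def
proof (rule Sup_mono, clarify)
  fix n and t :: "nat \<Rightarrow> real"
  assume mono: "mono_on {..n} t" and "a = t 0" "b = t n"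
  have "(\<Sum>i<n. dist (\<gamma>' (t i)) (\<gamma>' (t (Suc i)))) = (\<Sum>i<n. dist (\<gamma> (t i + c)) (\<gamma> (t (Suc i) + c)))"
  proof (rule sum.cong)
    fix i assume "i \<in> {..<n}"
    then have "t 0 \<le> t i" "t i \<le> t n" "t 0 \<le> t (Suc i)" "t (Suc i) \<le> t n"
      using mono by (auto simp: mono_on_def)
    then show "dist (\<gamma>' (t i)) (\<gamma>' (t (Suc i))) = dist (\<gamma> (t i + c)) (\<gamma> (t (Suc i) + c))"
      using assms \<open>a = t 0\<close> \<open>b = t n\<close> by simp
  qed simp
  moreover have "mono_on {..n} (\<lambda>i. t i + c)"
    using mono by (auto simp: mono_on_def)
  ultimately show "\<exists>S\<in>{ennreal (\<Sum>i<na. dist (\<gamma> (ta i)) (\<gamma> (ta (Suc i)))) | na ta.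
      mono_on {..na} ta \<and> ta 0 = t 0 + c \<and> ta na = t n + c}.
      ennreal (\<Sum>i<n. dist (\<gamma>' (t i)) (\<gamma>' (t (Suc i)))) \<le> S"
    by (intro bexI[of _ "ennreal (\<Sum>i<n. dist (\<gamma> (t i + c)) (\<gamma> (t (Suc i) + c)))"])
       (auto intro!: exI[of _ n] exI[of _ "\<lambda>i. t i + c"])
qed

lemma curve_length_reparametrization:
  assumes "\<And>t. a \<le> t \<Longrightarrow> t \<le> b \<Longrightarrow> \<gamma>' t = \<gamma> (t + c)"
  shows "curve_length \<gamma>' a b = curve_length \<gamma> (a + c) (b + c)"
proof (rule antisym)
  show "curve_length \<gamma>' a b \<le> curve_length \<gamma> (a + c) (b + c)"
    using assms by (rule curve_length_le_of_reparametrization)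
  have "curve_length \<gamma> (a + c) (b + c) \<le> curve_length \<gamma>' ((a + c) + (-c)) ((b + c) + (-c))"
    by (rule curve_length_le_of_reparametrization) (simp add: assms)
  then show "curve_length \<gamma> (a + c) (b + c) \<le> curve_length \<gamma>' a b" by simp
qed

lemma arclength_curve_constant:
  assumes "x \<in> E"
  shows "arclength_curve E x x 0 (\<lambda>_. x)"
proof -
  have "curve_length (\<lambda>_. x) s t = ennreal (t - s)" if "0 \<le> s" "s \<le> t" "t \<le> 0" for s t :: real
    using that curve_length_le_of_nonexpanding[of s t "\<lambda>_. x"] by (simp add: le_zero_eq ennreal_neg)
  then show ?thesis
    using assms by (auto simp: arclength_curve_def)
qed

lemma arclength_curve_tail:
  assumes \<gamma>: "arclength_curve E x y l \<gamma>" and a: "0 \<le> a" "a \<le> l"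
  shows "arclength_curve E (\<gamma> a) y (l - a) (\<lambda>t. \<gamma> (t + a))"
proof -
  have "curve_length (\<lambda>t. \<gamma> (t + a)) s t = ennreal (t - s)"
    if "0 \<le> s" "s \<le> t" "t \<le> l - a" for s t
    using curve_length_reparametrization[of s t "\<lambda>t. \<gamma> (t + a)" \<gamma> a] \<gamma> a that
    by (auto simp: arclength_curve_def)
  moreover have "continuous_on {0..l - a} (\<lambda>t. \<gamma> (t + a))"
    by (rule continuous_on_compose2[of "{0..l}" \<gamma>])
       (use \<gamma> a in \<open>auto simp: arclength_curve_def intro!: continuous_intros\<close>)
  moreover have "(\<lambda>t. \<gamma> (t + a)) ` {0..l - a} \<subseteq> E"
    using \<gamma> a by (force simp: arclength_curve_def)
  ultimately show ?thesis
    using \<gamma> a by (auto simp: arclength_curve_def)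
qed

definition join_curves :: "real \<Rightarrow> (real \<Rightarrow> 'a) \<Rightarrow> (real \<Rightarrow> 'a) \<Rightarrow> real \<Rightarrow> 'a" where
  "join_curves l \<gamma> \<gamma>' t = (if t \<le> l then \<gamma> t else \<gamma>' (t - l))"

text \<open>
  On a piece that crosses the junction, the length is at least the sum of the lengths of the two
  parts by superadditivity, and at most the length of the parameter interval because the joined curve
  is again nonexpanding, by the triangle inequality through the junction.
\<close>
lemma arclength_curve_join:
  assumes 1: "arclength_curve E x y l \<gamma>" and 2: "arclength_curve E y z l' \<gamma>'"
  shows "arclength_curve E x z (l + l') (join_curves l \<gamma> \<gamma>')"
proof -
  let ?j = "join_curves l \<gamma> \<gamma>'"
  have l: "0 \<le> l" "0 \<le> l'" and y: "\<gamma> l = y" "\<gamma>' 0 = y"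
    using 1 2 by (auto simp: arclength_curve_def)
  have j2: "?j t = \<gamma>' (t + (- l))" if "l \<le> t" for t
    using that y by (cases "t = l") (auto simp: join_curves_def)
  have j1: "?j t = \<gamma> (t + 0)" if "t \<le> l" for t
    using that by (simp add: join_curves_def)
  have nonexp: "dist (?j s) (?j t) \<le> t - s" if "0 \<le> s" "s \<le> t" "t \<le> l + l'" for s t
  proof -
    consider "t \<le> l" | "l \<le> s" | "s \<le> l" "l \<le> t" by linarith
    then show ?thesis
    proof cases
      case a: 1
      then show ?thesis
        using arclength_curve_dist_le[OF 1, of s t] that by (simp add: j1)
    next
      case b: 2
      then show ?thesis
        using arclength_curve_dist_le[OF 2, of "s - l" "t - l"] that by (simp add: j2)
    next
      case 3
      have "dist (?j s) (?j t) \<le> dist (\<gamma> s) y + dist y (\<gamma>' (t - l))"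
        using 3 by (simp add: j1 j2 dist_triangle)
      also have "\<dots> \<le> (l - s) + (t - l)"
        using arclength_curve_dist_le[OF 1, of s l] arclength_curve_dist_le[OF 2, of 0 "t - l"] 3 that l y
        by (intro add_mono) auto
      finally show ?thesis by simp
    qed
  qed
  have len1: "curve_length ?j s t = ennreal (t - s)" if "0 \<le> s" "s \<le> t" "t \<le> l" for s t
    using curve_length_reparametrization[of s t ?j \<gamma> 0] j1 1 that by (simp add: arclength_curve_def)
  have len2: "curve_length ?j s t = ennreal (t - s)" if "l \<le> s" "s \<le> t" "t \<le> l + l'" for s t
    using curve_length_reparametrization[of s t ?j \<gamma>' "- l"] j2 2 that by (simp add: arclength_curve_def)
  have len: "curve_length ?j s t = ennreal (t - s)" if st: "0 \<le> s" "s \<le> t" "t \<le> l + l'" for s t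
  proof (cases "s \<le> l \<and> l \<le> t")
    case True
    have "curve_length ?j s t \<le> ennreal (t - s)"
      by (rule curve_length_le_of_nonexpanding) (use nonexp st in auto)
    moreover have "ennreal (t - s) = curve_length ?j s l + curve_length ?j l t"
      using True st l by (simp add: len1 len2 flip: ennreal_plus)
    moreover have "\<dots> \<le> curve_length ?j s t"
      using True by (intro curve_length_superadditive) auto
    ultimately show ?thesis by simp
  next
    case False
    then show ?thesis using len1[of s t] len2[of s t] st by auto
  qed
  \<comment> \<open>A nonexpanding map is continuous.\<close>
  have "continuous_on {0..l + l'} ?j"
    unfolding continuous_on_iff
  proof (intro ballI allI impI)
    fix t e :: real assume t: "t \<in> {0..l + l'}" and "e > 0"
    have "dist (?j s) (?j t) < e" if "s \<in> {0..l + l'}" "dist s t < e" for s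
      using nonexp[of s t] nonexp[of t s] that t
      by (cases "s \<le> t") (auto simp: dist_real_def dist_commute)
    then show "\<exists>d>0. \<forall>s\<in>{0..l + l'}. dist s t < d \<longrightarrow> dist (?j s) (?j t) < e"
      using \<open>e > 0\<close> by blast
  qed
  moreover have "?j ` {0..l + l'} \<subseteq> E"
    using 1 2 by (force simp: arclength_curve_def join_curves_def)
  moreover have "?j 0 = x" "?j (l + l') = z"
    using 1 2 l j1[of 0] j2[of "l + l'"] by (auto simp: arclength_curve_def)
  ultimately show ?thesis
    unfolding arclength_curve_def using l len by simp
qed

lemma transversal_join:
  assumes "transversal l \<gamma> N" "transversal l' \<gamma>' N"
  shows "transversal (l + l') (join_curves l \<gamma> \<gamma>') N"
proof -
  have "{t\<in>{0..l + l'}. join_curves l \<gamma> \<gamma>' t \<in> N} \<subseteq>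
      {t\<in>{0..l}. \<gamma> t \<in> N} \<union> (\<lambda>t. l + t) ` {t\<in>{0..l'}. \<gamma>' t \<in> N}"
  proof
    fix t assume t: "t \<in> {t\<in>{0..l + l'}. join_curves l \<gamma> \<gamma>' t \<in> N}"
    show "t \<in> {t\<in>{0..l}. \<gamma> t \<in> N} \<union> (\<lambda>t. l + t) ` {t\<in>{0..l'}. \<gamma>' t \<in> N}"
      using t by (cases "t \<le> l") (auto simp: join_curves_def intro!: image_eqI[of _ _ "t - l"])
  qed
  then show ?thesis
    using assms unfolding transversal_def
    by (meson hausdorff1_0_subset hausdorff1_0_Un hausdorff1_0_translation)
qed

lemma transversal_tail:
  assumes "transversal l \<gamma> N" "0 \<le> a"
  shows "transversal (l - a) (\<lambda>t. \<gamma> (t + a)) N"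
proof -
  have "{t\<in>{0..l - a}. \<gamma> (t + a) \<in> N} \<subseteq> (\<lambda>t. - a + t) ` {t\<in>{0..l}. \<gamma> t \<in> N}"
  proof
    fix t assume "t \<in> {t\<in>{0..l - a}. \<gamma> (t + a) \<in> N}"
    then show "t \<in> (\<lambda>t. - a + t) ` {t\<in>{0..l}. \<gamma> t \<in> N}"
      using assms(2) by (intro image_eqI[of _ _ "t + a"]) auto
  qed
  then show ?thesis
    using assms unfolding transversal_def
    by (meson hausdorff1_0_subset hausdorff1_0_translation)
qed

section \<open>Integrals along curves\<close>

lemma curve_integrand_measurable:
  fixes \<gamma> :: "real \<Rightarrow> 'a::metric_space"
  assumes f: "f \<in> borel_measurable (restrict_space borel E)"
    and \<gamma>: "continuous_on {0..l} \<gamma>" "\<gamma> ` {0..l} \<subseteq> E"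
  shows "(\<lambda>t. ennreal (f (\<gamma> t)) * indicator {0..l} t) \<in> borel_measurable borel"
proof -
  have "\<gamma> \<in> measurable (restrict_space borel {0..l}) (restrict_space borel E)"
    using \<gamma> by (intro measurable_restrict_space2 borel_measurable_continuous_on_restrict)
               (auto simp: space_restrict_space)
  then have "(\<lambda>t. ennreal (f (\<gamma> t))) \<in> borel_measurable (restrict_space borel {0..l})"
    using f by measurable
  then show ?thesis
    by (subst (asm) borel_measurable_restrict_space_iff_ennreal) auto
qed

lemma curve_integral_constant: "curve_integral f 0 \<gamma> = 0"
proof -
  have "AE t in lborel. ennreal (f (\<gamma> t)) * indicator {0..0} t = 0"
    using AE_lborel_singleton[of "0::real"] by eventually_elim (auto simp: indicator_def)
  then show ?thesis
    unfolding curve_integral_def by (simp add: nn_integral_0_iff_AE nn_integral_cong_AE[where v="\<lambda>_. 0"])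
qed

text \<open>
  The two parts share the parameter \<open>a\<close>, which is a null set; the second part is an affine
  substitution.
\<close>
lemma curve_integral_split:
  assumes f: "f \<in> borel_measurable (restrict_space borel E)"
    and \<gamma>: "arclength_curve E x y l \<gamma>" and a: "0 \<le> a" "a \<le> l"
  shows "curve_integral f l \<gamma> = curve_integral f a \<gamma> + curve_integral f (l - a) (\<lambda>t. \<gamma> (t + a))"
proof -
  have m1: "(\<lambda>t. ennreal (f (\<gamma> t)) * indicator {0..a} t) \<in> borel_measurable borel"
    using \<gamma> a by (intro curve_integrand_measurable[OF f])
      (auto simp: arclength_curve_def elim!: continuous_on_subset)
  let ?h = "\<lambda>t. ennreal (f (\<gamma> (t + a))) * indicator {0..l - a} t"
  have m2: "?h \<in> borel_measurable borel"
    using arclength_curve_tail[OF \<gamma> a]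
    by (intro curve_integrand_measurable[OF f]) (auto simp: arclength_curve_def)
  have "curve_integral f l \<gamma> =
      (\<integral>\<^sup>+t. ennreal (f (\<gamma> t)) * indicator {0..a} t + ?h (- a + 1 * t) \<partial>lborel)"
    unfolding curve_integral_def
  proof (rule nn_integral_cong_AE)
    show "AE t in lborel. ennreal (f (\<gamma> t)) * indicator {0..l} t =
        ennreal (f (\<gamma> t)) * indicator {0..a} t + ?h (- a + 1 * t)"
      using AE_lborel_singleton[of a] by eventually_elim (use a in \<open>auto simp: indicator_def\<close>)
  qed
  also have "\<dots> = curve_integral f a \<gamma> + (\<integral>\<^sup>+t. ?h (- a + 1 * t) \<partial>lborel)"
    unfolding curve_integral_def using m1 measurable_compose[OF _ m2, of "\<lambda>t. - a + 1 * t" borel]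
    by (subst nn_integral_add) auto
  also have "(\<integral>\<^sup>+t. ?h (- a + 1 * t) \<partial>lborel) = curve_integral f (l - a) (\<lambda>t. \<gamma> (t + a))"
    unfolding curve_integral_def using nn_integral_real_affine[OF m2, of 1 "- a"] by simp
  finally show ?thesis .
qed

lemma curve_integral_join:
  assumes f: "f \<in> borel_measurable (restrict_space borel E)"
    and 1: "arclength_curve E x y l \<gamma>" and 2: "arclength_curve E y z l' \<gamma>'"
  shows "curve_integral f (l + l') (join_curves l \<gamma> \<gamma>') = curve_integral f l \<gamma> + curve_integral f l' \<gamma>'"
proof -
  have l: "0 \<le> l" "0 \<le> l'" and y: "\<gamma> l = \<gamma>' 0"
    using 1 2 by (auto simp: arclength_curve_def)
  have "curve_integral f l (join_curves l \<gamma> \<gamma>') = curve_integral f l \<gamma>"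
    unfolding curve_integral_def
    by (intro nn_integral_cong) (auto simp: join_curves_def indicator_def)
  moreover have "curve_integral f l' (\<lambda>t. join_curves l \<gamma> \<gamma>' (t + l)) = curve_integral f l' \<gamma>'"
    unfolding curve_integral_def
    by (intro nn_integral_cong) (auto simp: join_curves_def indicator_def y)
  ultimately show ?thesis
    using curve_integral_split[OF f arclength_curve_join[OF 1 2], of l] l by simp
qed

lemma curve_integral_mono:
  assumes "c \<le> b" shows "curve_integral f c \<gamma> \<le> curve_integral f b \<gamma>"
  unfolding curve_integral_def using assms by (intro nn_integral_mono) (auto simp: indicator_def)

lemma curve_integral_le:
  assumes "AE t in lborel. t \<in> {0..l} \<longrightarrow> f (\<gamma> t) \<le> K" and "0 \<le> K" "0 \<le> l"
  shows "curve_integral f l \<gamma> \<le> ennreal (K * l)"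
proof -
  have "curve_integral f l \<gamma> \<le> (\<integral>\<^sup>+t. ennreal K * indicator {0..l} t \<partial>lborel)"
    unfolding curve_integral_def
    by (rule nn_integral_mono_AE)
       (use assms(1) in \<open>eventually_elim, auto simp: indicator_def intro!: ennreal_leI\<close>)
  also have "\<dots> = ennreal (K * l)"
    using assms by (simp add: nn_integral_cmult_indicator ennreal_mult')
  finally show ?thesis .
qed

section \<open>The optical length function\<close>

lemma L_null_mono: "N \<subseteq> N' \<Longrightarrow> L_null E f N x y \<le> L_null E f N' x y"
  unfolding L_null_def Gamma_curves_def
  by (rule INF_superset_mono) (auto intro: transversal_subset)

lemma L_null_le_curve_integral:
  "(l, \<gamma>) \<in> Gamma_curves E f N x y \<Longrightarrow> L_null E f N x y \<le> curve_integral f l \<gamma>"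
  unfolding L_null_def by (rule INF_lower2) auto

lemma L_null_le_L_tilde: "N \<in> null_subsets M E \<Longrightarrow> L_null E f N x y \<le> L_tilde E M f x y"
  unfolding L_tilde_def by (rule SUP_upper)

lemma L_null_refl:
  assumes "x \<in> E"
  shows "L_null E f N x x = 0"
proof -
  have "transversal 0 (\<lambda>_. x) N"
    unfolding transversal_def by (rule hausdorff1_0_subset[OF hausdorff1_0_singleton[of 0]]) auto
  then have "(0, \<lambda>_. x) \<in> Gamma_curves E f N x x"
    using arclength_curve_constant[OF assms] by (simp add: Gamma_curves_def curve_integral_constant)
  then show ?thesis
    using L_null_le_curve_integral curve_integral_constant by (metis le_zero_eq)
qed

lemma le_INF_add_INF_ennreal:
  fixes c :: ennreal
  assumes "\<And>a b. a \<in> A \<Longrightarrow> b \<in> B \<Longrightarrow> c \<le> F a + G b"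
    and "\<And>a. a \<in> A \<Longrightarrow> F a < \<infinity>"
  shows "c \<le> (INF a\<in>A. F a) + (INF b\<in>B. G b)"
proof (cases "(INF b\<in>B. G b) = \<infinity>")
  case False
  have "c - (INF b\<in>B. G b) \<le> (INF a\<in>A. F a)"
  proof (rule INF_greatest)
    fix a assume a: "a \<in> A"
    have "c - F a \<le> (INF b\<in>B. G b)"
      using assms a by (intro INF_greatest) (force simp: ennreal_minus_le_iff)
    then show "c - (INF b\<in>B. G b) \<le> F a"
      using False assms(2)[OF a] by (auto simp: ennreal_minus_le_iff add.commute)
  qed
  then show ?thesis
    using False by (auto simp: ennreal_minus_le_iff add.commute)
qed simp

lemma L_null_triangle:
  assumes f: "f \<in> borel_measurable (restrict_space borel E)"
  shows "L_null E f N x z \<le> L_null E f N x y + L_null E f N y z"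
  unfolding L_null_def[of E f N x y] L_null_def[of E f N y z]
proof (rule le_INF_add_INF_ennreal, clarify)
  fix l \<gamma> l' \<gamma>'
  assume 1: "(l, \<gamma>) \<in> Gamma_curves E f N x y" and 2: "(l', \<gamma>') \<in> Gamma_curves E f N y z"
  then have a1: "arclength_curve E x y l \<gamma>" and a2: "arclength_curve E y z l' \<gamma>'"
    by (auto simp: Gamma_curves_def)
  note join = arclength_curve_join[OF a1 a2] curve_integral_join[OF f a1 a2]
  have "(l + l', join_curves l \<gamma> \<gamma>') \<in> Gamma_curves E f N x z"
    using 1 2 join by (simp add: Gamma_curves_def transversal_join)
  from L_null_le_curve_integral[OF this]
  show "L_null E f N x z \<le> curve_integral f l \<gamma> + curve_integral f l' \<gamma>'"
    by (simp add: join)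
qed (auto simp: Gamma_curves_def)

lemma L_tilde_triangle:
  assumes f: "f \<in> borel_measurable (restrict_space borel E)"
  shows "L_tilde E M f x z \<le> L_tilde E M f x y + L_tilde E M f y z"
  unfolding L_tilde_def[of E M f x z]
proof (rule SUP_least)
  fix N assume N: "N \<in> null_subsets M E"
  have "L_null E f N x z \<le> L_null E f N x y + L_null E f N y z"
    by (rule L_null_triangle[OF f])
  also have "\<dots> \<le> L_tilde E M f x y + L_tilde E M f y z"
    using N by (intro add_mono L_null_le_L_tilde)
  finally show "L_null E f N x z \<le> L_tilde E M f x y + L_tilde E M f y z" .
qed

lemma L_tilde_refl: "x \<in> E \<Longrightarrow> L_tilde E M f x x = 0"
  unfolding L_tilde_def by (auto simp: L_null_refl intro!: antisym SUP_least)

lemma null_subsets_Un: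
  "N \<in> null_subsets M E \<Longrightarrow> N' \<in> null_subsets M E \<Longrightarrow> N \<union> N' \<in> null_subsets M E"
  unfolding null_subsets_def by auto

text \<open>
  Near-shortest curves transversal to \<open>N1\<close> are outside \<open>N1\<close> at almost all parameters. Every point
  \<open>z\<close> of such a curve satisfies \<open>dist x z + dist z y < r\<close>, so a bound for \<open>f\<close> on this
  "ellipse" is enough. The bound is used with a global constant, giving the Lipschitz continuity of
  the optical length, and with \<open>f x + e\<close> on a small ball, giving its slope. The condition is symmetric
  in \<open>x\<close> and \<open>y\<close>, which spares a reversal of curves.
\<close>
lemma L_tilde_le_dist:
  assumes wF: "infinity_weak_Fubini E M"
    and N1: "N1 \<in> null_subsets M E"
    and x: "x \<in> E" and y: "y \<in> E"
    and K: "0 \<le> K" and r: "dist x y < r"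
    and f: "\<And>z. z \<in> E - N1 \<Longrightarrow> dist x z + dist z y < r \<Longrightarrow> f z \<le> K"
  shows "L_tilde E M f x y \<le> ennreal (K * dist x y)"
proof (cases "x = y")
  case True
  then show ?thesis using x by (simp add: L_tilde_refl)
next
  case False
  have "L_null E f N x y \<le> ennreal (K * dist x y)" if N: "N \<in> null_subsets M E" for N
  proof (rule ennreal_le_epsilon)
    fix e :: real assume "e > 0"
    \<comment> \<open>The first bound makes \<open>K * \<epsilon>\<close> at most \<open>e\<close>, the second keeps the curve shorter than \<open>r\<close>.\<close>
    define \<epsilon> where "\<epsilon> = min (e / (K + 1)) ((r - dist x y) / 2)"
    have \<epsilon>: "\<epsilon> > 0" "K * \<epsilon> \<le> e" "dist x y + \<epsilon> < r"
    proof -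
      show "\<epsilon> > 0" using K r \<open>e > 0\<close> by (simp add: \<epsilon>_def)
      have "K * \<epsilon> \<le> K * (e / (K + 1))" using K by (intro mult_left_mono) (auto simp: \<epsilon>_def)
      also have "\<dots> \<le> e" using K \<open>e > 0\<close> by (simp add: field_simps)
      finally show "K * \<epsilon> \<le> e" .
      have "\<epsilon> \<le> (r - dist x y) / 2" unfolding \<epsilon>_def by (rule min.cobounded2)
      then show "dist x y + \<epsilon> < r" using r by (simp add: field_simps)
    qed
    obtain l \<gamma> where \<gamma>: "arclength_curve E x y l \<gamma>" and tr: "transversal l \<gamma> (N \<union> N1)"
      and l: "l \<le> dist x y + \<epsilon>"
      using wF null_subsets_Un[OF N N1] x y False \<epsilon>(1) unfolding infinity_weak_Fubini_def by meson
    have l0: "0 \<le> l" and ends: "\<gamma> 0 = x" "\<gamma> l = y" and E: "\<gamma> ` {0..l} \<subseteq> E"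
      using \<gamma> by (auto simp: arclength_curve_def)
    have ae: "AE t in lborel. t \<in> {0..l} \<longrightarrow> f (\<gamma> t) \<le> K"
      using transversal_AE[OF tr]
    proof eventually_elim
      case (elim t)
      show ?case
      proof
        assume t: "t \<in> {0..l}"
        have "dist x (\<gamma> t) + dist (\<gamma> t) y \<le> t + (l - t)"
          using arclength_curve_dist_le[OF \<gamma>, of 0 t] arclength_curve_dist_le[OF \<gamma>, of t l] t ends
          by (intro add_mono) auto
        then show "f (\<gamma> t) \<le> K"
          using t elim E l \<epsilon>(3) by (intro f) auto
      qed
    qed
    have le: "curve_integral f l \<gamma> \<le> ennreal (K * l)"
      using ae K l0 by (rule curve_integral_le)
    then have "(l, \<gamma>) \<in> Gamma_curves E f N x y"
      using \<gamma> tr by (auto simp: Gamma_curves_def intro: transversal_subset le_less_trans)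
    then have "L_null E f N x y \<le> ennreal (K * l)"
      using L_null_le_curve_integral le order_trans by blast
    also have "\<dots> \<le> ennreal (K * dist x y + e)"
    proof (rule ennreal_leI)
      have "K * l \<le> K * (dist x y + \<epsilon>)" using l K by (rule mult_left_mono)
      also have "\<dots> \<le> K * dist x y + e" using \<epsilon>(2) by (simp add: algebra_simps)
      finally show "K * l \<le> K * dist x y + e" .
    qed
    also have "\<dots> = ennreal (K * dist x y) + ennreal e"
      using K \<open>e > 0\<close> by simp
    finally show "L_null E f N x y \<le> ennreal (K * dist x y) + ennreal e" .
  qed
  then show ?thesis unfolding L_tilde_def by (rule SUP_least)
qed

section \<open>A single null set realizing the supremum\<close>

text \<open>
  Iterating the doubling inequality up to a ball that contains all of \<open>E\<close> bounds the measure of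
  \<open>ball x (r / 2)\<close> from below, uniformly for \<open>x \<in> E\<close>. The balls of radius \<open>r / 2\<close> about an
  \<open>r\<close>-separated subset of \<open>E\<close> are disjoint and lie in one ball of finite measure, so the size of such
  subsets is bounded; one of maximal size is a finite \<open>r\<close>-net.
\<close>
lemma doubling_measure_bounded_separable:
  fixes M :: "'a::metric_space measure" and E :: "'a set"
  assumes dbl: "doubling_on UNIV M" and sets: "sets M = sets borel" and E: "bounded E"
  shows "\<exists>D\<subseteq>E. countable D \<and> E \<subseteq> closure D"
proof (cases "E = {}")
  case False
  then obtain x0 where "x0 \<in> E" by blast
  obtain R where R: "R > 0" "E \<subseteq> ball x0 R"
    using E bounded_subset_ballD by blast
  obtain C where C: "1 \<le> C"
    and dbl: "\<And>x r. r > 0 \<Longrightarrow> 0 < emeasure M (ball x r) \<and> emeasure M (ball x r) < \<infinity> \<and>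
        emeasure M (ball x (2 * r)) \<le> ennreal C * emeasure M (ball x r)"
    using dbl unfolding doubling_on_def by auto
  have meas: "ball x r \<in> sets M" for x r by (simp add: sets)
  have fin: "emeasure M (ball x r) < \<infinity>" for x r
    using dbl[of r x] by (cases "r > 0") (auto simp: ball_empty)
  then have fm: "ball x r \<in> fmeasurable M" for x r
    using meas by (intro fmeasurableI)
  have pos: "0 < measure M (ball x r)" if "r > 0" for x r
    using dbl[OF that, of x] by (auto simp: measure_def enn2real_positive_iff)
  have double: "measure M (ball x (2 * r)) \<le> C * measure M (ball x r)" if "r > 0" for x r
  proof -
    have "ennreal (measure M (ball x (2 * r))) \<le> ennreal (C * measure M (ball x r))"
      using dbl[OF that, of x] C fin
      by (simp add: emeasure_eq_ennreal_measure[OF less_imp_neq[OF fin[unfolded infinity_ennreal_def]]] ennreal_mult')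
    then show ?thesis using C by (subst (asm) ennreal_le_iff) auto
  qed
  have iterate: "measure M (ball x (2 ^ n * r)) \<le> C ^ n * measure M (ball x r)" if "r > 0" for x r n
  proof (induction n)
    case (Suc n)
    have "measure M (ball x (2 ^ Suc n * r)) \<le> C * measure M (ball x (2 ^ n * r))"
      using double[of "2 ^ n * r" x] that by (simp add: mult.assoc)
    also have "\<dots> \<le> C * (C ^ n * measure M (ball x r))"
      using C Suc by (intro mult_left_mono) auto
    finally show ?case by (simp add: mult.assoc)
  qed simp
  have net: "\<exists>k. finite k \<and> k \<subseteq> E \<and> (\<forall>x\<in>E. \<exists>p\<in>k. dist p x < r)" if r: "r > 0" for r
  proof -
    obtain n :: nat where n: "2 * R / (r / 2) < 2 ^ n"
      using real_arch_pow[of 2] by auto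
    define m where "m = measure M (ball x0 R) / C ^ n"
    have m: "m > 0" using pos R C by (simp add: m_def)
    have low: "m \<le> measure M (ball x (r / 2))" if "x \<in> E" for x
    proof -
      have "ball x0 R \<subseteq> ball x (2 * R)"
      proof
        fix z assume "z \<in> ball x0 R"
        then show "z \<in> ball x (2 * R)"
          using dist_triangle[of x z x0] that R by (auto simp: dist_commute)
      qed
      moreover have "2 * R \<le> 2 ^ n * (r / 2)"
        using n r by (simp add: field_simps)
      ultimately have "ball x0 R \<subseteq> ball x (2 ^ n * (r / 2))"
        by (meson order_trans subset_ball)
      then have "measure M (ball x0 R) \<le> measure M (ball x (2 ^ n * (r / 2)))"
        using fm meas by (intro measure_mono_fmeasurable)
      also have "\<dots> \<le> C ^ n * measure M (ball x (r / 2))"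
        using r by (intro iterate) simp
      finally show ?thesis using C by (simp add: m_def field_simps)
    qed
    define sep where "sep k \<longleftrightarrow> finite k \<and> k \<subseteq> E \<and> (\<forall>p\<in>k. \<forall>q\<in>k. p \<noteq> q \<longrightarrow> r \<le> dist p q)" for k
    have bound: "real (card k) \<le> measure M (ball x0 (R + r)) / m" if "sep k" for k
    proof -
      have k: "finite k" "k \<subseteq> E" and far: "\<And>p q. p \<in> k \<Longrightarrow> q \<in> k \<Longrightarrow> p \<noteq> q \<Longrightarrow> r \<le> dist p q"
        using that by (auto simp: sep_def)
      have disj: "disjoint_family_on (\<lambda>p. ball p (r / 2)) k"
        unfolding disjoint_family_on_def
      proof (intro ballI impI)
        fix p q assume pq: "p \<in> k" "q \<in> k" "p \<noteq> q"
        have False if "dist p z < r / 2" "dist q z < r / 2" for z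
          using far[OF pq] dist_triangle2[of p q z] that by simp
        then show "ball p (r / 2) \<inter> ball q (r / 2) = {}" by auto
      qed
      have "real (card k) * m = (\<Sum>p\<in>k. m)" by simp
      also have "\<dots> \<le> (\<Sum>p\<in>k. measure M (ball p (r / 2)))"
        using k low by (intro sum_mono) auto
      also have "\<dots> = measure M (\<Union>p\<in>k. ball p (r / 2))"
        using k disj meas fin
        by (intro measure_finite_Union[symmetric]) (auto simp: less_top[symmetric])
      also have "\<dots> \<le> measure M (ball x0 (R + r))"
      proof (rule measure_mono_fmeasurable)
        show "(\<Union>p\<in>k. ball p (r / 2)) \<subseteq> ball x0 (R + r)"
        proof clarify
          fix p z assume "p \<in> k" "z \<in> ball p (r / 2)"
          moreover have "dist x0 p < R" using \<open>p \<in> k\<close> k R by auto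
          ultimately show "z \<in> ball x0 (R + r)"
            using dist_triangle[of x0 z p] r by auto
        qed
      qed (use fm meas k in auto)
      finally show ?thesis using m by (simp add: field_simps)
    qed
    have "\<exists>k. sep k \<and> (\<forall>k'. sep k' \<longrightarrow> card k' \<le> card k)"
    proof (rule ex_has_greatest_nat[of sep "{}" card "Suc (nat \<lceil>measure M (ball x0 (R + r)) / m\<rceil>)"])
      show "sep {}" by (simp add: sep_def)
      show "\<forall>k. sep k \<longrightarrow> card k < Suc (nat \<lceil>measure M (ball x0 (R + r)) / m\<rceil>)"
      proof (intro allI impI)
        fix k assume "sep k"
        then have "real (card k) \<le> real_of_int \<lceil>measure M (ball x0 (R + r)) / m\<rceil>"
          using bound le_of_int_ceiling order_trans by blast
        then show "card k < Suc (nat \<lceil>measure M (ball x0 (R + r)) / m\<rceil>)" by linarith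
      qed
    qed
    then obtain k where k: "sep k" and max: "\<And>k'. sep k' \<Longrightarrow> card k' \<le> card k" by blast
    have "\<exists>p\<in>k. dist p x < r" if "x \<in> E" for x
    proof (rule ccontr)
      assume no: "\<not> (\<exists>p\<in>k. dist p x < r)"
      then have "x \<notin> k" using r by force
      moreover have "sep (insert x k)"
        using k no that by (auto simp: sep_def dist_commute not_less)
      ultimately show False using max[of "insert x k"] k by (simp add: sep_def)
    qed
    then show ?thesis using k by (auto simp: sep_def)
  qed
  then have "\<forall>n::nat. \<exists>k. finite k \<and> k \<subseteq> E \<and> (\<forall>x\<in>E. \<exists>p\<in>k. dist p x < inverse (Suc n))"
    by simp
  then obtain k where k: "\<And>n. finite (k n)" "\<And>n. k n \<subseteq> E"
    and near: "\<And>n x. x \<in> E \<Longrightarrow> \<exists>p\<in>k n. dist p x < inverse (Suc n)"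
    by metis
  show ?thesis
  proof (intro exI[of _ "\<Union>n. k n"] conjI)
    show "(\<Union>n. k n) \<subseteq> E" using k by blast
    show "countable (\<Union>n. k n)" using k by (auto intro: countable_finite)
    show "E \<subseteq> closure (\<Union>n. k n)"
    proof
      fix x assume x: "x \<in> E"
      show "x \<in> closure (\<Union>n. k n)"
        unfolding closure_approachable
      proof (intro allI impI)
        fix e :: real assume "e > 0"
        then obtain n where "inverse (Suc n) < e" using reals_Archimedean by blast
        then show "\<exists>p\<in>(\<Union>n. k n). dist p x < e" using near[OF x, of n] by force
      qed
    qed
  qed
qed simp

lemma null_subsets_UN:
  assumes "countable I" "\<And>i. i \<in> I \<Longrightarrow> N i \<in> null_subsets M E"
  shows "(\<Union>i\<in>I. N i) \<in> null_subsets M E"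
  using assms unfolding null_subsets_def by (auto intro!: null_sets_UN')

text \<open>
  A supremum in the extended nonnegative reals is reached along a sequence of null sets, and the
  union of the sequence is a null set at least as good as each of its members.
\<close>
lemma L_tilde_attained_pair:
  "\<exists>N\<in>null_subsets M E. L_tilde E M f x y = L_null E f N x y"
proof -
  have "null_subsets M E \<noteq> {}" by (auto simp: null_subsets_def)
  from ennreal_SUP_countable_SUP[OF this, of "\<lambda>N. L_null E f N x y"]
  obtain F :: "nat \<Rightarrow> ennreal" where F: "range F \<subseteq> (\<lambda>N. L_null E f N x y) ` null_subsets M E"
    and eq: "L_tilde E M f x y = (SUP i. F i)"
    unfolding L_tilde_def by blast
  then have "\<forall>i. \<exists>N\<in>null_subsets M E. F i = L_null E f N x y" by blast
  then obtain N where N: "\<And>i. N i \<in> null_subsets M E" "\<And>i. F i = L_null E f (N i) x y" by metis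
  have U: "(\<Union>i. N i) \<in> null_subsets M E" using N by (intro null_subsets_UN) auto
  have "L_tilde E M f x y \<le> L_null E f (\<Union>i. N i) x y"
    unfolding eq N(2) by (intro SUP_least L_null_mono) auto
  then show ?thesis using U L_null_le_L_tilde by (metis antisym)
qed

text \<open>
  For pairs from a countable dense set the union of the maximizing null sets works at once. It works
  for all other pairs because every \<open>L_null E f N\<close> obeys the triangle inequality and, being below
  \<open>L_tilde\<close>, the same Lipschitz bound.
\<close>
lemma L_tilde_attained:
  assumes f: "f \<in> borel_measurable (restrict_space borel E)"
    and D: "D \<subseteq> E" "countable D" "E \<subseteq> closure D"
    and C: "0 \<le> C"
    and Lip: "\<And>x y. x \<in> E \<Longrightarrow> y \<in> E \<Longrightarrow> L_tilde E M f x y \<le> ennreal (C * dist x y)"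
  shows "\<exists>N\<in>null_subsets M E. \<forall>x\<in>E. \<forall>y\<in>E. L_tilde E M f x y = L_null E f N x y"
proof -
  obtain N where N: "\<And>p q. N p q \<in> null_subsets M E"
    and att: "\<And>p q. L_tilde E M f p q = L_null E f (N p q) p q"
    using L_tilde_attained_pair by metis
  define N' where "N' = (\<Union>(p, q)\<in>D \<times> D. N p q)"
  have N': "N' \<in> null_subsets M E"
    unfolding N'_def using D N by (intro null_subsets_UN) auto
  have attD: "L_tilde E M f p q \<le> L_null E f N' p q" if "p \<in> D" "q \<in> D" for p q
    unfolding att[of p q] using that by (intro L_null_mono) (auto simp: N'_def)
  have "L_tilde E M f x y \<le> L_null E f N' x y" if xy: "x \<in> E" "y \<in> E" for x y
  proof (rule ennreal_le_epsilon)
    fix e :: real assume "e > 0"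
    \<comment> \<open>Four transitions between a point and its approximation are paid for, each at most \<open>e / 4\<close>.\<close>
    define \<delta> where "\<delta> = e / (4 * (C + 1))"
    have \<delta>: "\<delta> > 0" "C * \<delta> \<le> e / 4" using C \<open>e > 0\<close> by (auto simp: \<delta>_def field_simps)
    obtain p q where p: "p \<in> D" "dist p x < \<delta>" and q: "q \<in> D" "dist q y < \<delta>"
      using D xy \<delta>(1) unfolding closure_approachable subset_iff by meson
    have near: "L_tilde E M f a b \<le> ennreal (e / 4)" if "a \<in> E" "b \<in> E" "dist a b < \<delta>" for a b
    proof -
      have "C * dist a b \<le> C * \<delta>" using that C by (intro mult_left_mono) auto
      with \<delta>(2) have "ennreal (C * dist a b) \<le> ennreal (e / 4)" by (intro ennreal_leI) simp
      with Lip[OF that(1,2)] show ?thesis by (rule order_trans)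
    qed
    have pE: "p \<in> E" "q \<in> E" using p q D by auto
    have n: "L_tilde E M f x p \<le> ennreal (e / 4)" "L_tilde E M f q y \<le> ennreal (e / 4)"
      "L_null E f N' p x \<le> ennreal (e / 4)" "L_null E f N' y q \<le> ennreal (e / 4)"
      using near[of x p] near[of q y] near[of p x] near[of y q] p q pE xy L_null_le_L_tilde[OF N']
      by (auto simp: dist_commute intro: order_trans)
    have "L_tilde E M f x y \<le> L_tilde E M f x p + (L_tilde E M f p q + L_tilde E M f q y)"
      using L_tilde_triangle[OF f, of M x y p] L_tilde_triangle[OF f, of M p y q]
      by (meson add_left_mono order_trans)
    also have "\<dots> \<le> ennreal (e / 4) + (L_null E f N' p q + ennreal (e / 4))"
      using n attD p q by (intro add_mono) auto
    also have "\<dots> \<le> ennreal (e / 4) +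
        ((ennreal (e / 4) + (L_null E f N' x y + ennreal (e / 4))) + ennreal (e / 4))"
    proof (intro add_mono order_refl)
      have "L_null E f N' p q \<le> L_null E f N' p x + (L_null E f N' x y + L_null E f N' y q)"
        using L_null_triangle[OF f, of N' p q x] L_null_triangle[OF f, of N' x q y]
        by (meson add_left_mono order_trans)
      also have "\<dots> \<le> ennreal (e / 4) + (L_null E f N' x y + ennreal (e / 4))"
        using n by (intro add_mono) auto
      finally show "L_null E f N' p q \<le> \<dots>" .
    qed
    also have "\<dots> = L_null E f N' x y + (ennreal (e / 4) + ennreal (e / 4) + ennreal (e / 4) + ennreal (e / 4))"
      by (simp only: ac_simps)
    also have "ennreal (e / 4) + ennreal (e / 4) + ennreal (e / 4) + ennreal (e / 4) = ennreal e"
      using \<open>e > 0\<close> by (simp flip: ennreal_plus)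
    finally show "L_tilde E M f x y \<le> L_null E f N' x y + ennreal e" .
  qed
  with N' show ?thesis by (meson L_null_le_L_tilde antisym)
qed

section \<open>Bounding increments by the integral of a pointwise slope bound\<close>

text \<open>
  No derivative of \<open>h\<close> has to exist. At a tag \<open>t\<close> of a fine tagged division, the pointwise bound controls
  the increment of \<open>h\<close> over the interval of \<open>t\<close> by \<open>\<phi> t + e\<close> times its length; summation turns the increments into
  \<open>h a - h b\<close> and the bounds into a Riemann sum of \<open>\<phi>\<close>. On the exceptional set \<open>Z\<close> the integrand is
  replaced by the local Lipschitz constants. They may be unbounded, but the Henstock-Kurzweil
  integral ignores the values on a negligible set, however large.
\<close>
lemma increment_le_integral_of_pointwise_bound:
  fixes h \<phi> :: "real \<Rightarrow> real"
  assumes ab: "a \<le> b" and int: "(\<phi> has_integral I) {a..b}" and Z: "negligible Z"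
    and good: "\<And>t e. t \<in> {a..b} - Z \<Longrightarrow> e > 0 \<Longrightarrow>
      \<exists>d>0. \<forall>s\<in>{a..b}. \<bar>s - t\<bar> < d \<longrightarrow> \<bar>h s - h t\<bar> \<le> (\<phi> t + e) * \<bar>s - t\<bar>"
    and bad: "\<And>t. t \<in> {a..b} \<inter> Z \<Longrightarrow>
      \<exists>K. \<exists>d>0. \<forall>s\<in>{a..b}. \<bar>s - t\<bar> < d \<longrightarrow> \<bar>h s - h t\<bar> \<le> K * \<bar>s - t\<bar>"
  shows "h a - h b \<le> I"
proof (rule field_le_epsilon)
  fix \<epsilon> :: real assume "\<epsilon> > 0"
  \<comment> \<open>The final error is \<open>e\<close> from the Riemann sum and \<open>e * (b - a)\<close> from the pointwise bounds.\<close>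
  define e where "e = \<epsilon> / (1 + (b - a))"
  have e: "e > 0" "e * (1 + (b - a)) = \<epsilon>"
    using \<open>\<epsilon> > 0\<close> ab by (auto simp: e_def field_simps)
  obtain K where K: "\<And>t. t \<in> {a..b} \<inter> Z \<Longrightarrow>
      \<exists>d>0. \<forall>s\<in>{a..b}. \<bar>s - t\<bar> < d \<longrightarrow> \<bar>h s - h t\<bar> \<le> K t * \<bar>s - t\<bar>"
    using bad by metis
  define \<psi> where "\<psi> t = (if t \<in> Z then K t else \<phi> t)" for t
  have int': "(\<psi> has_integral I) {a..b}"
    by (rule has_integral_spike[OF Z _ int]) (simp add: \<psi>_def)
  have "\<exists>d>0. \<forall>s\<in>{a..b}. \<bar>s - t\<bar> < d \<longrightarrow> \<bar>h s - h t\<bar> \<le> (\<psi> t + e) * \<bar>s - t\<bar>"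
    if t: "t \<in> {a..b}" for t
  proof (cases "t \<in> Z")
    case True
    then obtain d where d: "d > 0"
      and le: "\<And>s. s \<in> {a..b} \<Longrightarrow> \<bar>s - t\<bar> < d \<Longrightarrow> \<bar>h s - h t\<bar> \<le> K t * \<bar>s - t\<bar>"
      using K[of t] t by auto
    have "\<bar>h s - h t\<bar> \<le> (\<psi> t + e) * \<bar>s - t\<bar>" if "s \<in> {a..b}" "\<bar>s - t\<bar> < d" for s
    proof -
      have "K t * \<bar>s - t\<bar> \<le> (\<psi> t + e) * \<bar>s - t\<bar>"
        using True e by (intro mult_right_mono) (auto simp: \<psi>_def)
      with le[OF that] show ?thesis by simp
    qed
    with d show ?thesis by blast
  next
    case False
    then show ?thesis using good[of t e] t e by (simp add: \<psi>_def)
  qed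
  then obtain d where d: "\<And>t. t \<in> {a..b} \<Longrightarrow> d t > 0"
    and le: "\<And>t s. t \<in> {a..b} \<Longrightarrow> s \<in> {a..b} \<Longrightarrow> \<bar>s - t\<bar> < d t \<Longrightarrow>
        \<bar>h s - h t\<bar> \<le> (\<psi> t + e) * \<bar>s - t\<bar>"
    by metis
  obtain g where g: "gauge g" and fine: "\<And>p. p tagged_division_of {a..b} \<Longrightarrow> g fine p \<Longrightarrow>
      norm ((\<Sum>(x,k)\<in>p. measure lborel k *\<^sub>R \<psi> x) - I) < e"
    using int' e(1) unfolding has_integral_real by meson
  define g' where "g' t = g t \<inter> ball t (if t \<in> {a..b} then d t else 1)" for t
  have "gauge g'"
    unfolding g'_def using g d by (intro gauge_Int gauge_ball_dependent) auto
  then obtain p where p: "p tagged_division_of {a..b}" and "g' fine p"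
    by (rule fine_division_exists_real)
  then have gp: "g fine p" and bp: "\<And>x k. (x, k) \<in> p \<Longrightarrow> k \<subseteq> ball x (if x \<in> {a..b} then d x else 1)"
    unfolding fine_def g'_def by blast+
  have piece: "h (Inf k) - h (Sup k) \<le> measure lborel k * \<psi> x + e * measure lborel k" if xk: "(x, k) \<in> p" for x k
  proof -
    obtain u v where k: "k = {u..v}"
      using tagged_division_ofD(4)[OF p xk] by auto
    have x: "x \<in> k" "k \<subseteq> {a..b}"
      using tagged_division_ofD(2,3)[OF p xk] by auto
    then have uv: "u \<le> x" "x \<le> v" "x \<in> {a..b}" "u \<in> {a..b}" "v \<in> {a..b}"
      using k by auto
    have "u \<in> k" "v \<in> k" using uv k by auto
    then have "u \<in> ball x (d x)" "v \<in> ball x (d x)"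
      using bp[OF xk] uv(3) by auto
    then have "\<bar>h u - h x\<bar> \<le> (\<psi> x + e) * \<bar>u - x\<bar>" "\<bar>h v - h x\<bar> \<le> (\<psi> x + e) * \<bar>v - x\<bar>"
      using uv le[of x u] le[of x v] by (auto simp: dist_real_def abs_minus_commute)
    then have "h u - h v \<le> (\<psi> x + e) * (x - u) + (\<psi> x + e) * (v - x)"
      using uv by simp
    also have "\<dots> = (v - u) * \<psi> x + e * (v - u)" by (simp add: algebra_simps)
    finally show ?thesis using uv k by simp
  qed
  have "h a - h b = - (\<Sum>(x,k)\<in>p. h (Sup k) - h (Inf k))"
    using additive_tagged_division_1[OF ab p, of h] by simp
  also have "\<dots> = (\<Sum>(x,k)\<in>p. h (Inf k) - h (Sup k))"
    by (simp add: case_prod_unfold flip: sum_negf)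
  also have "\<dots> \<le> (\<Sum>(x,k)\<in>p. measure lborel k *\<^sub>R \<psi> x + e * measure lborel k)"
    using piece by (intro sum_mono) auto
  also have "\<dots> = (\<Sum>(x,k)\<in>p. measure lborel k *\<^sub>R \<psi> x) + e * (\<Sum>(x,k)\<in>p. measure lborel k)"
    by (simp add: case_prod_unfold sum.distrib sum_distrib_left)
  also have "(\<Sum>(x,k)\<in>p. measure lborel k) = b - a"
    using additive_content_tagged_division[of p a b] p ab by simp
  also have "(\<Sum>(x,k)\<in>p. measure lborel k *\<^sub>R \<psi> x) + e * (b - a) \<le> I + e + e * (b - a)"
    using fine[OF p gp] by simp
  also have "\<dots> = I + \<epsilon>"
    using e(2) by (simp add: algebra_simps)
  finally show "h a - h b \<le> I + \<epsilon>" .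
qed

lemma slope_cong:
  assumes "\<And>y. y \<in> \<Omega> \<Longrightarrow> v y = w y" "x \<in> \<Omega>"
  shows "slope \<Omega> v x = slope \<Omega> w x"
  unfolding slope_def
proof (rule Limsup_eq)
  show "\<forall>\<^sub>F y in at x within \<Omega>. ereal (\<bar>v y - v x\<bar> / dist x y) = ereal (\<bar>w y - w x\<bar> / dist x y)"
    unfolding eventually_at_filter using assms by simp
qed

lemma slope_bound_imp_difference_bound:
  assumes "slope \<Omega> v x \<le> ereal c" "e > 0"
  shows "\<exists>d>0. \<forall>y\<in>\<Omega>. dist y x < d \<longrightarrow> \<bar>v y - v x\<bar> \<le> (c + e) * dist x y"
proof -
  have "Limsup (at x within \<Omega>) (\<lambda>y. ereal (\<bar>v y - v x\<bar> / dist x y)) < ereal (c + e)"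
    using assms unfolding slope_def by (auto intro: le_less_trans)
  then have "\<forall>\<^sub>F y in at x within \<Omega>. ereal (\<bar>v y - v x\<bar> / dist x y) < ereal (c + e)"
    by (rule Limsup_lessD)
  then obtain d where "d > 0"
    and d: "\<And>y. y \<in> \<Omega> \<Longrightarrow> y \<noteq> x \<Longrightarrow> dist y x < d \<Longrightarrow> \<bar>v y - v x\<bar> / dist x y < c + e"
    unfolding eventually_at by auto
  have "\<bar>v y - v x\<bar> \<le> (c + e) * dist x y" if "y \<in> \<Omega>" "dist y x < d" for y
  proof (cases "y = x")
    case False
    with d[OF that(1) False that(2)] show ?thesis by (simp add: field_simps)
  qed simp
  with \<open>d > 0\<close> show ?thesis by blast
qed

lemma difference_bound_imp_slope_bound:
  assumes "0 < d" "\<And>y. y \<in> \<Omega> \<Longrightarrow> dist y x < d \<Longrightarrow> \<bar>v y - v x\<bar> \<le> c * dist x y"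
  shows "slope \<Omega> v x \<le> ereal c"
  unfolding slope_def
proof (rule Limsup_bounded)
  show "\<forall>\<^sub>F y in at x within \<Omega>. ereal (\<bar>v y - v x\<bar> / dist x y) \<le> ereal c"
    unfolding eventually_at using assms by (intro exI[of _ d]) (auto simp: field_simps)
qed

text \<open>
  \<open>v \<circ> \<gamma>\<close> inherits the slope bound \<open>f \<circ> \<gamma>\<close> at every parameter outside \<open>\<gamma> -` N\<close>, since \<open>\<gamma>\<close> is
  nonexpanding, and is pointwise Lipschitz at all parameters. Transversality makes \<open>\<gamma> -` N\<close>
  negligible.
\<close>
lemma decrease_along_curve_le_integral:
  assumes f: "f \<in> borel_measurable (restrict_space borel E)"
    and f0: "\<And>z. z \<in> E \<Longrightarrow> 0 \<le> f z"
    and Lip: "locally_Lipschitz_on \<Omega> v"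
    and slope: "\<And>z. z \<in> \<Omega> - N \<Longrightarrow> slope \<Omega> v z \<le> ereal (f z)"
    and \<gamma>: "arclength_curve E x y l \<gamma>" and tr: "transversal l \<gamma> N"
    and c: "0 \<le> c" "c \<le> l" and in\<Omega>: "\<gamma> ` {0..c} \<subseteq> \<Omega>"
  shows "ennreal (v (\<gamma> 0) - v (\<gamma> c)) \<le> curve_integral f c \<gamma>"
proof (cases "curve_integral f c \<gamma> < \<infinity>")
  case True
  have E: "\<gamma> ` {0..c} \<subseteq> E" and cont: "continuous_on {0..c} \<gamma>"
    using \<gamma> c by (auto simp: arclength_curve_def elim!: continuous_on_subset)
  define \<phi> where "\<phi> t = (if t \<in> {0..c} then f (\<gamma> t) else 0)" for t
  have \<phi>0: "0 \<le> \<phi> t" for t using f0 E by (simp add: \<phi>_def image_subset_iff)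
  have \<phi>_eq: "ennreal (\<phi> t) = ennreal (f (\<gamma> t)) * indicator {0..c} t" for t
    by (simp add: \<phi>_def indicator_def)
  have "(\<lambda>t. ennreal (\<phi> t)) \<in> borel_measurable borel"
    unfolding \<phi>_eq by (rule curve_integrand_measurable[OF f cont E])
  then have \<phi>m: "\<phi> \<in> borel_measurable lborel"
    using borel_measurable_enn2real[of "\<lambda>t. ennreal (\<phi> t)" lborel] \<phi>0 by simp
  have nn: "(\<integral>\<^sup>+t. ennreal (\<phi> t) \<partial>lborel) = curve_integral f c \<gamma>"
    by (simp add: \<phi>_eq curve_integral_def)
  then have intble: "integrable lborel \<phi>"
    using \<phi>m \<phi>0 True by (intro integrableI_nonneg) auto
  have eq: "ennreal (integral\<^sup>L lborel \<phi>) = curve_integral f c \<gamma>"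
    using nn_integral_eq_integral[OF intble] \<phi>0 nn by simp
  have \<phi>_supp: "(\<lambda>t. if t \<in> {0..c} then \<phi> t else 0) = \<phi>"
    by (auto simp: \<phi>_def)
  have "(\<phi> has_integral integral\<^sup>L lborel \<phi>) UNIV"
    by (rule has_integral_integral_lborel[OF intble])
  then have int: "(\<phi> has_integral integral\<^sup>L lborel \<phi>) {0..c}"
    using has_integral_restrict_UNIV[of "{0..c}" \<phi>] \<phi>_supp by simp
  have "v (\<gamma> 0) - v (\<gamma> c) \<le> integral\<^sup>L lborel \<phi>"
  proof (rule increment_le_integral_of_pointwise_bound[where h = "\<lambda>t. v (\<gamma> t)", OF c(1) int])
    show "negligible {t\<in>{0..l}. \<gamma> t \<in> N}"
      using tr unfolding transversal_def by (rule hausdorff1_0_imp_negligible)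
  next
    fix t e :: real assume t: "t \<in> {0..c} - {t\<in>{0..l}. \<gamma> t \<in> N}" and "e > 0"
    then have "t \<in> {0..c}" "t \<in> {0..l}" using c by auto
    with t in\<Omega> have "\<gamma> t \<in> \<Omega> - N" "\<phi> t = f (\<gamma> t)"
      by (auto simp only: \<phi>_def if_True)
    then have "slope \<Omega> v (\<gamma> t) \<le> ereal (\<phi> t)"
      using slope by simp
    from slope_bound_imp_difference_bound[OF this \<open>e > 0\<close>]
    obtain d where "d > 0"
      and d: "\<And>y. y \<in> \<Omega> \<Longrightarrow> dist y (\<gamma> t) < d \<Longrightarrow> \<bar>v y - v (\<gamma> t)\<bar> \<le> (\<phi> t + e) * dist (\<gamma> t) y"
      by blast
    have "\<bar>v (\<gamma> s) - v (\<gamma> t)\<bar> \<le> (\<phi> t + e) * \<bar>s - t\<bar>" if s: "s \<in> {0..c}" "\<bar>s - t\<bar> < d" for s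
    proof -
      have dist: "dist (\<gamma> s) (\<gamma> t) \<le> \<bar>s - t\<bar>"
        using s t c by (intro arclength_curve_dist_le[OF \<gamma>]) auto
      then have "\<bar>v (\<gamma> s) - v (\<gamma> t)\<bar> \<le> (\<phi> t + e) * dist (\<gamma> t) (\<gamma> s)"
        using s in\<Omega> by (intro d) auto
      also have "\<dots> \<le> (\<phi> t + e) * \<bar>s - t\<bar>"
        using dist \<phi>0[of t] \<open>e > 0\<close> by (intro mult_left_mono) (auto simp: dist_commute)
      finally show ?thesis .
    qed
    with \<open>d > 0\<close> show "\<exists>d>0. \<forall>s\<in>{0..c}. \<bar>s - t\<bar> < d \<longrightarrow>
        \<bar>v (\<gamma> s) - v (\<gamma> t)\<bar> \<le> (\<phi> t + e) * \<bar>s - t\<bar>"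
      by blast
  next
    fix t assume t: "t \<in> {0..c} \<inter> {t\<in>{0..l}. \<gamma> t \<in> N}"
    then have "\<gamma> t \<in> \<Omega>" using in\<Omega> by auto
    then obtain r C where "r > 0" and C: "C-lipschitz_on (ball (\<gamma> t) r \<inter> \<Omega>) v"
      using Lip unfolding locally_Lipschitz_on_def by blast
    have "\<bar>v (\<gamma> s) - v (\<gamma> t)\<bar> \<le> C * \<bar>s - t\<bar>" if s: "s \<in> {0..c}" "\<bar>s - t\<bar> < r" for s
    proof -
      have dist: "dist (\<gamma> s) (\<gamma> t) \<le> \<bar>s - t\<bar>"
        using s t c by (intro arclength_curve_dist_le[OF \<gamma>]) auto
      have "dist (v (\<gamma> s)) (v (\<gamma> t)) \<le> C * dist (\<gamma> s) (\<gamma> t)"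
        using s dist in\<Omega> \<open>\<gamma> t \<in> \<Omega>\<close> \<open>r > 0\<close>
        by (intro lipschitz_onD[OF C]) (auto simp: dist_commute)
      also have "\<dots> \<le> C * \<bar>s - t\<bar>"
        using dist lipschitz_on_nonneg[OF C] by (intro mult_left_mono)
      finally show ?thesis by (simp add: dist_real_def)
    qed
    with \<open>r > 0\<close> show "\<exists>K. \<exists>d>0. \<forall>s\<in>{0..c}. \<bar>s - t\<bar> < d \<longrightarrow>
        \<bar>v (\<gamma> s) - v (\<gamma> t)\<bar> \<le> K * \<bar>s - t\<bar>"
      by blast
  qed
  then show ?thesis
    unfolding eq[symmetric] by (rule ennreal_leI)
qed (simp add: less_top[symmetric])

text \<open>
  The curve is cut at the first point \<open>z\<close> where it meets the boundary. Up to \<open>z\<close> it runs inside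
  \<open>\<Omega>\<close>, where the slope bound controls the decrease of \<open>v\<close>. At \<open>z\<close> one has \<open>v z \<le> g z\<close>, and the rest
  of the curve is a competitor for \<open>L_null (closure \<Omega>) f N z y\<close>, which bounds \<open>g z - g y\<close>. The
  hypothesis on \<open>g\<close> has to be for the same null set \<open>N\<close> to which the curve is transversal; this is why
  one null set must realize \<open>L_tilde\<close> for all pairs of points.
\<close>
lemma weak_subsolution_le_curve_integral_add_boundary_value:
  assumes \<Omega>: "open \<Omega>"
    and f: "f \<in> borel_measurable (restrict_space borel (closure \<Omega>))"
    and f0: "\<And>z. z \<in> closure \<Omega> \<Longrightarrow> 0 \<le> f z"
    and Lip: "locally_Lipschitz_on \<Omega> v" and cont: "continuous_on (closure \<Omega>) v"
    and slope: "\<And>z. z \<in> \<Omega> - N \<Longrightarrow> slope \<Omega> v z \<le> ereal (f z)"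
    and bdry: "\<And>z. z \<in> frontier \<Omega> \<Longrightarrow> v z \<le> g z"
    and g: "\<And>z. z \<in> frontier \<Omega> \<Longrightarrow> ennreal (g z - g y) \<le> L_null (closure \<Omega>) f N z y"
    and y: "y \<in> frontier \<Omega>"
    and \<gamma>: "(l, \<gamma>) \<in> Gamma_curves (closure \<Omega>) f N x y"
  shows "ennreal (v x - g y) \<le> curve_integral f l \<gamma>"
proof -
  have curve: "arclength_curve (closure \<Omega>) x y l \<gamma>" and tr: "transversal l \<gamma> N"
    and fin: "curve_integral f l \<gamma> < \<infinity>"
    using \<gamma> by (auto simp: Gamma_curves_def)
  then have l: "0 \<le> l" and \<gamma>c: "continuous_on {0..l} \<gamma>" and E: "\<gamma> ` {0..l} \<subseteq> closure \<Omega>"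
    and ends: "\<gamma> 0 = x" "\<gamma> l = y"
    by (auto simp: arclength_curve_def)
  define H where "H = {0..l} \<inter> \<gamma> -` frontier \<Omega>"
  have "compact H"
    unfolding compact_eq_bounded_closed H_def
    by (intro conjI bounded_Int continuous_closed_preimage[OF \<gamma>c]) auto
  moreover have "l \<in> H" using l ends y by (simp add: H_def)
  ultimately obtain b where b: "b \<in> H" "\<And>t. t \<in> H \<Longrightarrow> b \<le> t"
    using compact_attains_inf[of H] by auto
  then have b0: "0 \<le> b" "b \<le> l" "\<gamma> b \<in> frontier \<Omega>" by (auto simp: H_def)
  have before: "\<gamma> t \<in> \<Omega>" if "0 \<le> t" "t < b" for t
  proof -
    have "\<gamma> t \<in> closure \<Omega>" using that b0 E by auto
    moreover have "\<gamma> t \<notin> frontier \<Omega>" using b(2)[of t] that b0 by (auto simp: H_def)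
    ultimately show ?thesis using \<Omega> by (simp add: frontier_def interior_open)
  qed
  have fin_b: "curve_integral f b \<gamma> < \<infinity>"
    using curve_integral_mono[OF b0(2)] fin by (rule le_less_trans)
  define I where "I = enn2real (curve_integral f b \<gamma>)"
  have I: "curve_integral f b \<gamma> = ennreal I" "0 \<le> I"
    using fin_b by (auto simp: I_def)
  have decr: "v x - v (\<gamma> b) \<le> I"
  proof (cases "b = 0")
    case True
    then show ?thesis using I ends by simp
  next
    case False
    \<comment> \<open>The point at \<open>b\<close> itself is outside \<open>\<Omega>\<close> and is reached only in the limit.\<close>
    have le: "v x - v (\<gamma> t) \<le> I" if t: "t \<in> {0..<b}" for t
    proof -
      have "ennreal (v (\<gamma> 0) - v (\<gamma> t)) \<le> curve_integral f t \<gamma>"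
        using t b0 before
        by (intro decrease_along_curve_le_integral[OF f f0 Lip slope curve tr]) auto
      also have "\<dots> \<le> ennreal I"
        using curve_integral_mono[of t b f \<gamma>] t I by simp
      finally show ?thesis using I(2) ends by (auto simp: ennreal_le_iff2)
    qed
    have "continuous_on {0..b} (\<lambda>t. v x - v (\<gamma> t))"
      using b0 E by (intro continuous_intros continuous_on_compose2[OF cont] continuous_on_subset[OF \<gamma>c]) auto
    moreover have "closure {0..<b} = {0..b}" using False b0 by simp
    ultimately have "(\<lambda>t. v x - v (\<gamma> t)) ` {0..b} \<subseteq> {..I}"
      using le by (metis (no_types, lifting) atMost_iff closed_atMost image_closure_subset image_subsetI)
    then show ?thesis using b0 by (simp add: image_subset_iff)
  qed
  have tail: "(l - b, \<lambda>t. \<gamma> (t + b)) \<in> Gamma_curves (closure \<Omega>) f N (\<gamma> b) y"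
    and tail_fin: "curve_integral f (l - b) (\<lambda>t. \<gamma> (t + b)) < \<infinity>"
    using arclength_curve_tail[OF curve b0(1,2)] transversal_tail[OF tr b0(1)]
      curve_integral_split[OF f curve b0(1,2)] fin
    by (auto simp: Gamma_curves_def)
  define J where "J = enn2real (curve_integral f (l - b) (\<lambda>t. \<gamma> (t + b)))"
  have J: "curve_integral f (l - b) (\<lambda>t. \<gamma> (t + b)) = ennreal J" "0 \<le> J"
    using tail_fin by (auto simp: J_def)
  have "ennreal (g (\<gamma> b) - g y) \<le> ennreal J"
    using g[OF b0(3)] L_null_le_curve_integral[OF tail] J(1) by simp
  then have "g (\<gamma> b) - g y \<le> J"
    using J(2) by (auto simp: ennreal_le_iff2)
  with decr bdry[OF b0(3)] have "v x - g y \<le> I + J" by simp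
  moreover have "curve_integral f l \<gamma> = ennreal (I + J)"
    using curve_integral_split[OF f curve b0(1,2)] I J by simp
  ultimately show ?thesis
    by (simp add: ennreal_leI)
qed

section \<open>The maximal weak subsolution\<close>

text \<open>
  A geodesic from a point of \<open>\<Omega>\<close> to a point outside is connected and must cross the boundary.
\<close>
lemma geodesic_space_frontier_nonempty:
  fixes \<Omega> :: "'a::metric_space set"
  assumes "geodesic_space TYPE('a)" "\<Omega> \<noteq> {}" "\<Omega> \<noteq> UNIV"
  shows "frontier \<Omega> \<noteq> {}"
proof -
  obtain x y where xy: "x \<in> \<Omega>" "y \<notin> \<Omega>" using assms by blast
  obtain \<gamma> where \<gamma>: "\<gamma> 0 = x" "\<gamma> (dist x y) = y"
    and iso: "\<And>s t. s \<in> {0..dist x y} \<Longrightarrow> t \<in> {0..dist x y} \<Longrightarrow> dist (\<gamma> s) (\<gamma> t) = \<bar>s - t\<bar>"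
    using assms(1) unfolding geodesic_space_def by metis
  have "continuous_on {0..dist x y} \<gamma>"
    unfolding continuous_on_iff using iso by (metis dist_real_def)
  then have "connected (\<gamma> ` {0..dist x y})"
    by (intro connected_continuous_image) auto
  moreover have "x \<in> \<gamma> ` {0..dist x y}" "y \<in> \<gamma> ` {0..dist x y}"
    using \<gamma> by (auto intro: image_eqI[of _ _ 0] image_eqI[of _ _ "dist x y"])
  ultimately have "\<gamma> ` {0..dist x y} \<inter> frontier \<Omega> \<noteq> {}"
    using xy by (intro connected_Int_frontier) auto
  then show ?thesis by blast
qed

lemma AE_imp_exceptional_null_subset:
  assumes "space M = UNIV" "AE x in M. x \<in> E \<longrightarrow> P x" "E \<subseteq> E'"
  shows "{x \<in> E. \<not> P x} \<in> null_subsets M E'"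
proof -
  obtain N where "N \<in> null_sets M" "{x \<in> space M. \<not> (x \<in> E \<longrightarrow> P x)} \<subseteq> N"
    using assms(2) unfolding eventually_ae_filter by blast
  then have "{x \<in> E. \<not> P x} \<in> null_sets (completion M)"
    using assms(1) by (intro null_sets_completion_subset[OF _ null_sets_completionI]) auto
  then show ?thesis using assms(3) by (auto simp: null_subsets_def)
qed

text \<open>
  Inequalities between boundary data and optical lengths become inequalities of extended nonnegative
  reals, in which no infinities have to be subtracted.
\<close>
lemma ereal_le_enn2ereal_add_iff:
  "ereal a \<le> enn2ereal c + ereal b \<longleftrightarrow> ennreal (a - b) \<le> c"
proof (cases c rule: ennreal_cases)
  case (real r)
  then show ?thesis by (auto simp: enn2ereal_ennreal ennreal_le_iff2)
qed simp

text \<open>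
  The null set where the slope condition for \<open>v\<close> fails is added to the null set \<open>N\<close> that realizes
  \<open>L_tilde\<close>: enlarging \<open>N\<close> keeps the compatibility of \<open>g\<close>, and transversal curves then avoid both.
\<close>
lemma weak_subsolution_le_u_tilde:
  assumes space: "space M = UNIV" and \<Omega>: "open \<Omega>"
    and f: "f \<in> borel_measurable (restrict_space borel (closure \<Omega>))"
    and f0: "\<And>z. z \<in> closure \<Omega> \<Longrightarrow> 0 \<le> f z"
    and N: "N \<in> null_subsets M (closure \<Omega>)"
    and att: "\<And>x y. x \<in> closure \<Omega> \<Longrightarrow> y \<in> closure \<Omega> \<Longrightarrow>
      L_tilde (closure \<Omega>) M f x y = L_null (closure \<Omega>) f N x y"
    and g: "\<And>x y. x \<in> frontier \<Omega> \<Longrightarrow> y \<in> frontier \<Omega> \<Longrightarrow>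
      ereal (g x) \<le> enn2ereal (L_tilde (closure \<Omega>) M f x y) + ereal (g y)"
    and v: "v \<in> S_weak \<Omega> M f g"
  shows "ereal (v x) \<le> u_tilde \<Omega> M f g x"
  unfolding u_tilde_def
proof (rule INF_greatest)
  fix y assume y: "y \<in> frontier \<Omega>"
  have FE: "frontier \<Omega> \<subseteq> closure \<Omega>" by (simp add: frontier_def)
  define N' where "N' = N \<union> {z \<in> \<Omega>. \<not> slope \<Omega> v z \<le> ereal (f z)}"
  have N': "N' \<in> null_subsets M (closure \<Omega>)"
    unfolding N'_def using v
    by (intro null_subsets_Un N AE_imp_exceptional_null_subset space)
       (auto simp: S_weak_def closure_subset)
  have gN': "ennreal (g z - g y) \<le> L_null (closure \<Omega>) f N' z y" if z: "z \<in> frontier \<Omega>" for z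
  proof -
    have "ennreal (g z - g y) \<le> L_tilde (closure \<Omega>) M f z y"
      using g[OF z y] by (simp add: ereal_le_enn2ereal_add_iff)
    also have "\<dots> = L_null (closure \<Omega>) f N z y"
      using z y FE by (intro att) auto
    also have "\<dots> \<le> L_null (closure \<Omega>) f N' z y"
      by (rule L_null_mono) (simp add: N'_def)
    finally show ?thesis .
  qed
  have "ennreal (v x - g y) \<le> L_null (closure \<Omega>) f N' x y"
    unfolding L_null_def
  proof (rule INF_greatest, clarify)
    fix l \<gamma> assume "(l, \<gamma>) \<in> Gamma_curves (closure \<Omega>) f N' x y"
    then show "ennreal (v x - g y) \<le> curve_integral f l \<gamma>"
      using v
      by (intro weak_subsolution_le_curve_integral_add_boundary_value[OF \<Omega> f f0 _ _ _ _ gN' y])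
         (auto simp: S_weak_def N'_def)
  qed
  also have "\<dots> \<le> L_tilde (closure \<Omega>) M f x y"
    by (rule L_null_le_L_tilde[OF N'])
  finally show "ereal (v x) \<le> enn2ereal (L_tilde (closure \<Omega>) M f x y) + ereal (g y)"
    by (simp add: ereal_le_enn2ereal_add_iff)
qed

text \<open>
  Since \<open>w\<close> is an infimum of functions that vary by at most \<open>L_tilde\<close> (triangle inequality), so does
  \<open>w\<close>. Compatibility of \<open>g\<close> at a fixed boundary point bounds the infimum from below, and the choice
  \<open>y = x\<close> gives the boundary inequality.
\<close>
lemma u_tilde_finite_and_controlled:
  assumes f: "f \<in> borel_measurable (restrict_space borel (closure \<Omega>))"
    and fin: "\<And>x y. x \<in> closure \<Omega> \<Longrightarrow> y \<in> closure \<Omega> \<Longrightarrow> L_tilde (closure \<Omega>) M f x y < \<infinity>"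
    and F: "frontier \<Omega> \<noteq> {}"
    and g: "\<And>x y. x \<in> frontier \<Omega> \<Longrightarrow> y \<in> frontier \<Omega> \<Longrightarrow>
      ereal (g x) \<le> enn2ereal (L_tilde (closure \<Omega>) M f x y) + ereal (g y)"
  obtains w where "\<And>x. x \<in> closure \<Omega> \<Longrightarrow> u_tilde \<Omega> M f g x = ereal (w x)"
    and "\<And>x y. x \<in> closure \<Omega> \<Longrightarrow> y \<in> closure \<Omega> \<Longrightarrow>
      ennreal (w x - w y) \<le> L_tilde (closure \<Omega>) M f x y"
    and "\<And>x. x \<in> frontier \<Omega> \<Longrightarrow> w x \<le> g x"
proof -
  have FE: "\<And>y. y \<in> frontier \<Omega> \<Longrightarrow> y \<in> closure \<Omega>" by (simp add: frontier_def)
  define d where "d x y = enn2real (L_tilde (closure \<Omega>) M f x y)" for x y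
  have d0: "0 \<le> d x y" for x y by (simp add: d_def)
  have d: "L_tilde (closure \<Omega>) M f x y = ennreal (d x y)" if "x \<in> closure \<Omega>" "y \<in> closure \<Omega>" for x y
    using fin[OF that] by (simp add: d_def)
  have tri: "d x z \<le> d x y + d y z" if "x \<in> closure \<Omega>" "y \<in> closure \<Omega>" "z \<in> closure \<Omega>" for x y z
  proof -
    have "ennreal (d x z) \<le> ennreal (d x y + d y z)"
      using L_tilde_triangle[OF f, of M x z y] that by (simp add: d d0)
    then show ?thesis using d0 by (subst (asm) ennreal_le_iff) auto
  qed
  have g': "g x \<le> d x y + g y" if "x \<in> frontier \<Omega>" "y \<in> frontier \<Omega>" for x y
    using g[OF that] d[OF FE FE, OF that] d0 by (simp add: enn2ereal_ennreal)
  define w where "w x = (INF y\<in>frontier \<Omega>. d x y + g y)" for x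
  obtain z where z: "z \<in> frontier \<Omega>" using F by blast
  have lower: "g z - d z x \<le> d x y + g y" if "x \<in> closure \<Omega>" "y \<in> frontier \<Omega>" for x y
    using g'[OF z that(2)] tri[OF FE[OF z] that(1) FE[OF that(2)]] by simp
  have bdd: "bdd_below ((\<lambda>y. d x y + g y) ` frontier \<Omega>)" if "x \<in> closure \<Omega>" for x
    using lower[OF that] by (intro bdd_belowI2)
  have w_le: "w x \<le> d x y + g y" if "x \<in> closure \<Omega>" "y \<in> frontier \<Omega>" for x y
    unfolding w_def using bdd that by (intro cINF_lower)
  show ?thesis
  proof
    fix x assume x: "x \<in> closure \<Omega>"
    have u: "u_tilde \<Omega> M f g x = (INF y\<in>frontier \<Omega>. ereal (d x y + g y))"
      unfolding u_tilde_def using d[OF x FE] d0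
      by (intro INF_cong) (auto simp: enn2ereal_ennreal)
    have "ereal (g z - d z x) \<le> u_tilde \<Omega> M f g x"
      unfolding u using lower[OF x] by (intro INF_greatest) simp
    moreover have "u_tilde \<Omega> M f g x \<le> ereal (d x z + g z)"
      unfolding u using z by (rule INF_lower)
    ultimately have "\<bar>INF y\<in>frontier \<Omega>. ereal (d x y + g y)\<bar> \<noteq> \<infinity>"
      unfolding u by auto
    then show "u_tilde \<Omega> M f g x = ereal (w x)"
      unfolding u w_def by (rule ereal_INF[symmetric])
  next
    fix x y assume xy: "x \<in> closure \<Omega>" "y \<in> closure \<Omega>"
    have "w x - d x y \<le> w y"
      unfolding w_def[of y]
    proof (rule cINF_greatest[OF F])
      fix p assume p: "p \<in> frontier \<Omega>"
      show "w x - d x y \<le> d y p + g p"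
        using w_le[OF xy(1) p] tri[OF xy FE[OF p]] by simp
    qed
    then show "ennreal (w x - w y) \<le> L_tilde (closure \<Omega>) M f x y"
      unfolding d[OF xy] by (intro ennreal_leI) simp
  next
    fix x assume x: "x \<in> frontier \<Omega>"
    have "d x x = 0" using FE[OF x] by (simp add: d_def L_tilde_refl)
    then show "w x \<le> g x" using w_le[OF FE[OF x] x] by simp
  qed
qed

text \<open>
  Upper semicontinuity bounds \<open>f\<close> by \<open>f x + e\<close> near \<open>x\<close> off \<open>N\<close>, and near-shortest curves from \<open>x\<close>
  to nearby points stay near \<open>x\<close>. So the optical length, which bounds the increments of \<open>w\<close>, is
  locally at most \<open>(f x + e) * dist x y\<close>.
\<close>
lemma u_tilde_slope_le:
  assumes wF: "infinity_weak_Fubini (closure \<Omega>) M" and \<Omega>: "open \<Omega>"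
    and N: "N \<in> null_subsets M \<Omega>" and usc: "usc_on (\<Omega> - N) f"
    and x: "x \<in> \<Omega>" "x \<notin> N" and fx: "0 \<le> f x"
    and w: "\<And>x y. x \<in> closure \<Omega> \<Longrightarrow> y \<in> closure \<Omega> \<Longrightarrow>
      ennreal (w x - w y) \<le> L_tilde (closure \<Omega>) M f x y"
  shows "slope \<Omega> w x \<le> ereal (f x)"
proof (rule ereal_le_epsilon2)
  fix e :: real assume "e > 0"
  have NE: "N \<in> null_subsets M (closure \<Omega>)"
    using N closure_subset[of \<Omega>] by (auto simp: null_subsets_def)
  have "openin (top_of_set (\<Omega> - N)) {z \<in> \<Omega> - N. f z < f x + e}"
    using usc unfolding usc_on_def by blast
  then obtain r1 where r1: "r1 > 0" "ball x r1 \<inter> (\<Omega> - N) \<subseteq> {z \<in> \<Omega> - N. f z < f x + e}"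
    using x \<open>e > 0\<close> unfolding openin_contains_ball by force
  obtain r2 where r2: "r2 > 0" "ball x r2 \<subseteq> \<Omega>"
    using \<Omega> x(1) unfolding open_contains_ball by blast
  define r where "r = min r1 r2"
  have near: "f z \<le> f x + e" if "z \<in> closure \<Omega> - N" "dist x z < r" for z
  proof -
    have "z \<in> ball x r1 \<inter> (\<Omega> - N)" using that r2 by (auto simp: r_def)
    then show ?thesis using r1(2) by force
  qed
  have "\<bar>w y - w x\<bar> \<le> (f x + e) * dist x y" if y: "y \<in> \<Omega>" "dist y x < r" for y
  proof -
    have E: "x \<in> closure \<Omega>" "y \<in> closure \<Omega>" using x y closure_subset by auto
    have K: "0 \<le> f x + e" using fx \<open>e > 0\<close> by simp
    have "L_tilde (closure \<Omega>) M f x y \<le> ennreal ((f x + e) * dist x y)"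
    proof (rule L_tilde_le_dist[OF wF NE E K])
      show "dist x y < r" using y by (simp add: dist_commute)
      show "f z \<le> f x + e" if "z \<in> closure \<Omega> - N" "dist x z + dist z y < r" for z
        using that zero_le_dist[of z y] by (intro near) linarith+
    qed
    then have 1: "ennreal (w x - w y) \<le> ennreal ((f x + e) * dist x y)"
      using w[OF E] by (rule order_trans[rotated])
    have "L_tilde (closure \<Omega>) M f y x \<le> ennreal ((f x + e) * dist y x)"
    proof (rule L_tilde_le_dist[OF wF NE E(2,1) K y(2)])
      show "f z \<le> f x + e" if "z \<in> closure \<Omega> - N" "dist y z + dist z x < r" for z
        using that zero_le_dist[of y z] dist_commute[of x z] by (intro near) linarith+
    qed
    then have 2: "ennreal (w y - w x) \<le> ennreal ((f x + e) * dist x y)"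
      using w[OF E(2,1)] by (simp add: dist_commute)
    have "0 \<le> (f x + e) * dist x y" using K by simp
    with 1 2 show ?thesis by (auto simp: ennreal_le_iff2)
  qed
  then have "slope \<Omega> w x \<le> ereal (f x + e)"
    using r1 r2 by (intro difference_bound_imp_slope_bound[of r]) (auto simp: r_def)
  then show "slope \<Omega> w x \<le> ereal (f x) + ereal e" by simp
qed

theorem proposition6p9:
  fixes M :: "'a::complete_space measure"
    and \<Omega> :: "'a set"
    and f g :: "'a \<Rightarrow> real"
  assumes "geodesic_space TYPE('a)"
    and "sets M = sets borel"
    and "doubling_on UNIV M"
    and "open \<Omega>" "connected \<Omega>" "\<Omega> \<noteq> {}" "bounded \<Omega>" "\<Omega> \<noteq> UNIV"
    and "doubling_on (closure \<Omega>) M"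
    and "infinity_weak_Fubini (closure \<Omega>) M"
    and "f \<in> borel_measurable (restrict_space borel (closure \<Omega>))"
    and "\<forall>x\<in>closure \<Omega>. 0 < f x"
    and "\<exists>C::real. AE x in M. x \<in> closure \<Omega> \<longrightarrow> \<bar>f x\<bar> \<le> C"
    and "0 < (INF x\<in>\<Omega>. f x)"
    and "\<forall>x\<in>frontier \<Omega>. \<forall>y\<in>frontier \<Omega>.
           ereal (g x) \<le> enn2ereal (L_tilde (closure \<Omega>) M f x y) + ereal (g y)"
  shows "(\<forall>v\<in>S_weak \<Omega> M f g. \<forall>x\<in>closure \<Omega>. ereal (v x) \<le> u_tilde \<Omega> M f g x) \<and>
         ((\<exists>N\<in>null_subsets M \<Omega>. usc_on (\<Omega> - N) f) \<longrightarrow>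
            (\<forall>x\<in>closure \<Omega>. \<bar>u_tilde \<Omega> M f g x\<bar> \<noteq> \<infinity>) \<and>
            (\<lambda>x. real_of_ereal (u_tilde \<Omega> M f g x)) \<in> S_weak \<Omega> M f g \<and>
            (\<forall>x\<in>\<Omega>. u_tilde \<Omega> M f g x = (SUP v\<in>S_weak \<Omega> M f g. ereal (v x))))"
proof -
  let ?E = "closure \<Omega>" and ?u = "u_tilde \<Omega> M f g"
  note geo = assms(1) and sets = assms(2) and dbl = assms(3) and \<Omega> = assms(4)
    and wF = assms(10) and f = assms(11)
  have f0: "0 \<le> f z" if "z \<in> ?E" for z using assms(12) that by (simp add: less_imp_le)
  have g: "ereal (g x) \<le> enn2ereal (L_tilde ?E M f x y) + ereal (g y)"
    if "x \<in> frontier \<Omega>" "y \<in> frontier \<Omega>" for x y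
    using assms(15) that by blast
  have space: "space M = UNIV" using sets_eq_imp_space_eq[OF sets] by simp

  obtain C0 where "AE x in M. x \<in> ?E \<longrightarrow> \<bar>f x\<bar> \<le> C0" using assms(13) by blast
  then have N1: "{x \<in> ?E. \<not> \<bar>f x\<bar> \<le> C0} \<in> null_subsets M ?E"
    by (intro AE_imp_exceptional_null_subset space) auto
  define C where "C = max C0 0"
  have C: "0 \<le> C" by (simp add: C_def)
  have Lip: "L_tilde ?E M f x y \<le> ennreal (C * dist x y)" if "x \<in> ?E" "y \<in> ?E" for x y
    \<comment> \<open>The bound for \<open>f\<close> is global, so any radius above \<open>dist x y\<close> serves.\<close>
    by (rule L_tilde_le_dist[OF wF N1 that C, where r = "dist x y + 1"]) (auto simp: C_def)
  obtain D where D: "D \<subseteq> ?E" "countable D" "?E \<subseteq> closure D"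
    using doubling_measure_bounded_separable[OF dbl sets bounded_closure[OF assms(7)]] by blast
  obtain N where N: "N \<in> null_subsets M ?E"
    and att: "\<And>x y. x \<in> ?E \<Longrightarrow> y \<in> ?E \<Longrightarrow> L_tilde ?E M f x y = L_null ?E f N x y"
    using L_tilde_attained[OF f D C Lip] by blast
  have part1: "ereal (v x) \<le> ?u x" if "v \<in> S_weak \<Omega> M f g" for v x
    using weak_subsolution_le_u_tilde[OF space \<Omega> f f0 N att g that] by blast

  have part2: "(\<forall>x\<in>?E. \<bar>?u x\<bar> \<noteq> \<infinity>) \<and> (\<lambda>x. real_of_ereal (?u x)) \<in> S_weak \<Omega> M f g \<and>
      (\<forall>x\<in>\<Omega>. ?u x = (SUP v\<in>S_weak \<Omega> M f g. ereal (v x)))"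
    if usc: "N0 \<in> null_subsets M \<Omega>" "usc_on (\<Omega> - N0) f" for N0
  proof -
    have F: "frontier \<Omega> \<noteq> {}"
      by (rule geodesic_space_frontier_nonempty[OF geo assms(6,8)])
    have fin: "L_tilde ?E M f x y < \<infinity>" if "x \<in> ?E" "y \<in> ?E" for x y
      using Lip[OF that] by (auto intro: le_less_trans)
    obtain w where u: "\<And>x. x \<in> ?E \<Longrightarrow> ?u x = ereal (w x)"
      and w: "\<And>x y. x \<in> ?E \<Longrightarrow> y \<in> ?E \<Longrightarrow> ennreal (w x - w y) \<le> L_tilde ?E M f x y"
      and wg: "\<And>x. x \<in> frontier \<Omega> \<Longrightarrow> w x \<le> g x"
      using u_tilde_finite_and_controlled[OF f fin F g] by blast
    define U where "U x = real_of_ereal (?u x)" for x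
    have U: "U x = w x" if "x \<in> ?E" for x using u[OF that] by (simp add: U_def)
    have "C-lipschitz_on ?E U"
    proof (rule lipschitz_onI)
      fix x y assume xy: "x \<in> ?E" "y \<in> ?E"
      have "ennreal (w x - w y) \<le> ennreal (C * dist x y)" "ennreal (w y - w x) \<le> ennreal (C * dist x y)"
        using w Lip xy by (meson order_trans, metis dist_commute order_trans)
      moreover have "0 \<le> C * dist x y" using C by simp
      ultimately show "dist (U x) (U y) \<le> C * dist x y"
        using xy by (auto simp: U dist_real_def ennreal_le_iff2)
    qed (rule C)
    note U_Lip = this
    have "C-lipschitz_on (ball x 1 \<inter> \<Omega>) U" for x
      by (rule lipschitz_on_subset[OF U_Lip]) (use closure_subset in blast)
    then have "locally_Lipschitz_on \<Omega> U"
      unfolding locally_Lipschitz_on_def using zero_less_one by blast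
    moreover have "continuous_on ?E U"
      by (rule lipschitz_on_continuous_on[OF U_Lip])
    moreover have "AE x in M. x \<in> \<Omega> \<longrightarrow> slope \<Omega> U x \<le> ereal (f x)"
    proof -
      have "AE x in completion M. x \<notin> N0"
        using usc(1) by (intro AE_not_in) (simp add: null_subsets_def)
      then have "AE x in M. x \<notin> N0" by (simp add: AE_completion_iff)
      then show ?thesis
      proof eventually_elim
        case (elim x)
        show ?case
        proof
          assume x: "x \<in> \<Omega>"
          have "slope \<Omega> U x = slope \<Omega> w x"
            using x closure_subset[of \<Omega>] by (intro slope_cong U) auto
          also have "\<dots> \<le> ereal (f x)"
            using x closure_subset[of \<Omega>] by (intro u_tilde_slope_le[OF wF \<Omega> usc _ elim _ w] f0) auto
          finally show "slope \<Omega> U x \<le> ereal (f x)" .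
        qed
      qed
    qed
    moreover have "U x \<le> g x" if "x \<in> frontier \<Omega>" for x
      using wg[OF that] U[of x] that by (simp add: frontier_def)
    ultimately have sub: "U \<in> S_weak \<Omega> M f g" by (auto simp: S_weak_def)
    have "?u x = (SUP v\<in>S_weak \<Omega> M f g. ereal (v x))" if x: "x \<in> \<Omega>" for x
    proof (rule antisym)
      have "?u x = ereal (U x)" using x closure_subset[of \<Omega>] u U by auto
      also have "\<dots> \<le> (SUP v\<in>S_weak \<Omega> M f g. ereal (v x))"
        using sub by (rule SUP_upper)
      finally show "?u x \<le> (SUP v\<in>S_weak \<Omega> M f g. ereal (v x))" .
      show "(SUP v\<in>S_weak \<Omega> M f g. ereal (v x)) \<le> ?u x"
        using part1 by (rule SUP_least)
    qed
    with sub u show ?thesis unfolding U_def[abs_def] by auto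
  qed
  show ?thesis
  proof (intro conjI[OF _ impI] ballI)
    show "ereal (v x) \<le> ?u x" if "v \<in> S_weak \<Omega> M f g" for v x
      using that by (rule part1)
    assume "\<exists>N\<in>null_subsets M \<Omega>. usc_on (\<Omega> - N) f"
    then obtain N0 where "N0 \<in> null_subsets M \<Omega>" "usc_on (\<Omega> - N0) f"
      by (elim bexE)
    then show "(\<forall>x\<in>?E. \<bar>?u x\<bar> \<noteq> \<infinity>) \<and> (\<lambda>x. real_of_ereal (?u x)) \<in> S_weak \<Omega> M f g \<and>
        (\<forall>x\<in>\<Omega>. ?u x = (SUP v\<in>S_weak \<Omega> M f g. ereal (v x)))"
      by (rule part2)
  qed
qed

end
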